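(* Assume there exist $w^{(0)}\in\mathcal K$ and $\epsilon_0$ such that $F(w^{(0)})-F_*\le\epsilon_0$, and a constant $G$ such that $\|\partial f(w;\xi)\|_2\le G$. Let $\theta=0$, $\epsilon\le\epsilon_0/4$, $\omega=1$, and $K=\lceil\log_2(\epsilon_0/\epsilon)\rceil$ in the algorithm RASSG. Assume $D_1^{(1)}$ is sufficiently large so that there exists $\hat\epsilon_1\in[\epsilon,\epsilon_0/2]$ with $D_1^{(1)}=\frac{B_{\hat\epsilon_1}\epsilon_0}{\hat\epsilon_1}$. Let $\hat\delta=\frac{\delta}{K(K+1)}$ and $t_1=\max\{9,1728\log(1/\hat\delta)\}\,\big(GD_1^{(1)}/\epsilon_0\big)^2$. Then with at most $S=\lceil\log_2(\hat\epsilon_1/\epsilon)\rceil+1$ calls of ASSG-c, RASSG finds a solution $w^{(S)}$ such that, with probability $1-\delta$, $$F(w^{(S)})-F_*\le2\epsilon .$$ The total number of iterations of RASSG for obtaining a $2\epsilon$-optimal solution is upper bounded by $$T_S=O\left(\Big\lceil\log_2\frac{\epsilon_0}{\epsilon}\Big\rceil\,\log(1/\delta)\,\frac{G^2B_{\hat\epsilon_1}^2}{\epsilon^2}\right).$$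
   Context: Setting: $\mathcal K\subseteq\mathbb R^d$ is a closed convex set, $\xi$ is a random variable, $f(w;\xi)$ is a convex function of $w$, $F(w)=\mathbb E_\xi[f(w;\xi)]$, $F_*=\min_{w\in\mathcal K}F(w)$, and $\mathcal K_*=\arg\min_{w\in\mathcal K}F(w)$ is the (nonempty) optimal set. $\partial f(w;\xi)$ denotes a subgradient of $f(\cdot;\xi)$ at $w$. For $\varepsilon>0$, $\mathcal L_\varepsilon=\{w\in\mathcal K:F(w)=F_*+\varepsilon\}$ and $B_\varepsilon=\max_{w\in\mathcal L_\varepsilon}\min_{v\in\mathcal K_*}\|w-v\|_2$ is the maximum distance between points of the $\varepsilon$-level set and the optimal set. $\mathcal B(w,r)$ is the Euclidean ball of radius $r$ centred at $w$ and $\Pi_C$ is Euclidean projection onto $C$. A point $w$ is $2\epsilon$-optimal if $F(w)-F_*\le2\epsilon$. Algorithm ASSG-c$(w_0,K,t,D_1,\epsilon_0)$: set $\eta_1=\epsilon_0/(3G^2)$. For $k=1,\dots,K$: let $w_1^k=w_{k-1}$; for $\tau=1,\dots,t-1$ let $w^k_{\tau+1}=\Pi_{\mathcal K\cap\mathcal B(w_{k-1},D_k)}[w^k_\tau-\eta_k\,\partial f(w^k_\tau;\xi^k_\tau)]$ with $\xi^k_\tau$ independent samples of $\xi$; let $w_k=\frac1t\sum_{\tau=1}^tw^k_\tau$, $\eta_{k+1}=\eta_k/2$, $D_{k+1}=D_k/2$. Output $w_K$. Algorithm RASSG (inputs $w^{(0)},K,D_1^{(1)},t_1,\epsilon_0,\omega\in(0,1]$;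 parameter $\theta$): set $\epsilon_0^{(1)}=\epsilon_0$. For $s=1,\dots,S$: let $w^{(s)}=$ ASSG-c$(w^{(s-1)},K,t_s,D_1^{(s)},\epsilon_0^{(s)})$, then set $t_{s+1}=t_s2^{2(1-\theta)}$, $D_1^{(s+1)}=D_1^{(s)}2^{1-\theta}$, $\epsilon_0^{(s+1)}=\omega\,\epsilon_0^{(s)}$. Output $w^{(S)}$.
   Formalization: Adds the assumption that points of level e in [ε, ε̂₁) lie within B_ε̂₁ of the optimal set (the claim fails for some constrained 𝒦 without it), and replaces log(1/δ) in T_S by log(1/δ)+log K, or, for δ≤1/2, a hidden constant multiple of 1+log K, as the stated O-bound drops log K. *)

theory Defs
  imports "HOL-Probability.Probability"
begin

definition subdifferential :: "('a::real_inner \<Rightarrow> real) \<Rightarrow> 'a \<Rightarrow> 'a set" where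
  "subdifferential h w = {v. \<forall>u. h w + v \<bullet> (u - w) \<le> h u}"

text \<open>The random variable \<open>\<xi>\<close> enters through its law \<open>P\<close>.\<close>

definition objective :: "'z measure \<Rightarrow> ('a \<Rightarrow> 'z \<Rightarrow> real) \<Rightarrow> 'a \<Rightarrow> real" where
  "objective P f w = (\<integral>z. f w z \<partial>P)"

definition opt_value :: "('a \<Rightarrow> real) \<Rightarrow> 'a set \<Rightarrow> real" where
  "opt_value F \<K> = (INF w\<in>\<K>. F w)"

definition opt_set :: "('a \<Rightarrow> real) \<Rightarrow> 'a set \<Rightarrow> 'a set" where
  "opt_set F \<K> = {w. is_arg_min F (\<lambda>u. u \<in> \<K>) w}"

definition level_set :: "('a \<Rightarrow> real) \<Rightarrow> 'a set \<Rightarrow> real \<Rightarrow> 'a set" where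
  "level_set F \<K> e = {w \<in> \<K>. F w = opt_value F \<K> + e}"

text \<open>The quantity \<open>B\<^sub>e\<close>, the maximal distance from the \<open>e\<close>-level set to the optimal set.
  It is written as a supremum of reals, hence only meaningful if the level set is nonempty
  and its distances to the optimal set are bounded. It need not be monotone in \<open>e\<close>: a ray
  from the optimal set through a point of the \<open>e\<close>-level set may leave \<open>\<K>\<close> before it reaches a
  higher level.\<close>

definition level_dist :: "('a::metric_space \<Rightarrow> real) \<Rightarrow> 'a set \<Rightarrow> real \<Rightarrow> real" where
  "level_dist F \<K> e = (SUP w\<in>level_set F \<K> e. infdist w (opt_set F \<K>))"

text \<open>One stage of ASSG-c on a sample path \<open>z\<close>: \<open>sgd_iterate \<K> g \<eta> c D z j\<close> is the iterate
  \<open>w\<^sub>\<tau>\<close> with \<open>\<tau> = j + 1\<close>, started at the centre \<open>c\<close>; \<open>g w z\<close> is the stochastic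
  subgradient. A stage of length \<open>t\<close> averages \<open>w\<^sub>1, \<dots>, w\<^sub>t\<close>.\<close>

primrec sgd_iterate ::
  "'a::euclidean_space set \<Rightarrow> ('a \<Rightarrow> 'z \<Rightarrow> 'a) \<Rightarrow> real \<Rightarrow> 'a \<Rightarrow> real \<Rightarrow> (nat \<Rightarrow> 'z) \<Rightarrow> nat \<Rightarrow> 'a" where
  "sgd_iterate \<K> g \<eta> c D z 0 = c"
| "sgd_iterate \<K> g \<eta> c D z (Suc j) =
     (let w = sgd_iterate \<K> g \<eta> c D z j
      in closest_point (\<K> \<inter> cball c D) (w - \<eta> *\<^sub>R g w (z j)))"

definition sgd_average ::
  "'a::euclidean_space set \<Rightarrow> ('a \<Rightarrow> 'z \<Rightarrow> 'a) \<Rightarrow> real \<Rightarrow> 'a \<Rightarrow> real \<Rightarrow> (nat \<Rightarrow> 'z) \<Rightarrow> nat \<Rightarrow> 'a" where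
  "sgd_average \<K> g \<eta> c D z t = (1 / real t) *\<^sub>R (\<Sum>j<t. sgd_iterate \<K> g \<eta> c D z j)"

text \<open>The triple after \<open>k\<close> stages of ASSG-c is \<open>(w\<^sub>k, \<eta>\<^sub>k\<^sub>+\<^sub>1, D\<^sub>k\<^sub>+\<^sub>1)\<close>. Stage \<open>k + 1\<close> uses the
  samples \<open>z k\<close>.\<close>

primrec assg_c_state ::
  "'a::euclidean_space set \<Rightarrow> ('a \<Rightarrow> 'z \<Rightarrow> 'a) \<Rightarrow> real \<Rightarrow> (nat \<Rightarrow> nat \<Rightarrow> 'z) \<Rightarrow>
   'a \<Rightarrow> nat \<Rightarrow> real \<Rightarrow> real \<Rightarrow> nat \<Rightarrow> 'a \<times> real \<times> real" where
  "assg_c_state \<K> g G z w0 t D1 \<epsilon>0 0 = (w0, \<epsilon>0 / (3 * G\<^sup>2), D1)"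
| "assg_c_state \<K> g G z w0 t D1 \<epsilon>0 (Suc k) =
     (let (w, \<eta>, D) = assg_c_state \<K> g G z w0 t D1 \<epsilon>0 k
      in (sgd_average \<K> g \<eta> w D (z k) t, \<eta> / 2, D / 2))"

definition assg_c ::
  "'a::euclidean_space set \<Rightarrow> ('a \<Rightarrow> 'z \<Rightarrow> 'a) \<Rightarrow> real \<Rightarrow> (nat \<Rightarrow> nat \<Rightarrow> 'z) \<Rightarrow>
   'a \<Rightarrow> nat \<Rightarrow> nat \<Rightarrow> real \<Rightarrow> real \<Rightarrow> 'a" where
  "assg_c \<K> g G z w0 K t D1 \<epsilon>0 = fst (assg_c_state \<K> g G z w0 t D1 \<epsilon>0 K)"

text \<open>The state after \<open>s\<close> calls of ASSG-c is \<open>(w\<^sup>s, t\<^sub>s\<^sub>+\<^sub>1, D\<^sub>s\<^sub>+\<^sub>1, \<epsilon>\<^sub>s\<^sub>+\<^sub>1, N)\<close>, where \<open>N\<close> is the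
  number of iterations so far. The lengths \<open>t\<^sub>s\<close> are real numbers by their update rule; the call
  rounds them up. A call of ASSG-c with \<open>K\<close> stages of length \<open>t\<close> counts \<open>K * t\<close> iterations.\<close>

primrec rassg_state ::
  "'a::euclidean_space set \<Rightarrow> ('a \<Rightarrow> 'z \<Rightarrow> 'a) \<Rightarrow> real \<Rightarrow> (nat \<Rightarrow> nat \<Rightarrow> nat \<Rightarrow> 'z) \<Rightarrow>
   real \<Rightarrow> real \<Rightarrow> 'a \<Rightarrow> nat \<Rightarrow> real \<Rightarrow> real \<Rightarrow> real \<Rightarrow> nat \<Rightarrow> 'a \<times> real \<times> real \<times> real \<times> nat" where
  "rassg_state \<K> g G z \<theta> \<omega> w0 K D1 t1 \<epsilon>0 0 = (w0, t1, D1, \<epsilon>0, 0)"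
| "rassg_state \<K> g G z \<theta> \<omega> w0 K D1 t1 \<epsilon>0 (Suc s) =
     (let (w, t, D, e, N) = rassg_state \<K> g G z \<theta> \<omega> w0 K D1 t1 \<epsilon>0 s
      in (assg_c \<K> g G (z s) w K (nat \<lceil>t\<rceil>) D e,
          t * 2 powr (2 * (1 - \<theta>)), D * 2 powr (1 - \<theta>), \<omega> * e, N + K * nat \<lceil>t\<rceil>))"

definition rassg ::
  "'a::euclidean_space set \<Rightarrow> ('a \<Rightarrow> 'z \<Rightarrow> 'a) \<Rightarrow> real \<Rightarrow> (nat \<Rightarrow> nat \<Rightarrow> nat \<Rightarrow> 'z) \<Rightarrow>
   real \<Rightarrow> real \<Rightarrow> 'a \<Rightarrow> nat \<Rightarrow> real \<Rightarrow> real \<Rightarrow> real \<Rightarrow> nat \<Rightarrow> 'a" where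
  "rassg \<K> g G z \<theta> \<omega> w0 K D1 t1 \<epsilon>0 S =
     (case rassg_state \<K> g G z \<theta> \<omega> w0 K D1 t1 \<epsilon>0 S of (w, t, D, e, N) \<Rightarrow> w)"

definition rassg_iterations ::
  "'a::euclidean_space set \<Rightarrow> ('a \<Rightarrow> 'z \<Rightarrow> 'a) \<Rightarrow> real \<Rightarrow> (nat \<Rightarrow> nat \<Rightarrow> nat \<Rightarrow> 'z) \<Rightarrow>
   real \<Rightarrow> real \<Rightarrow> 'a \<Rightarrow> nat \<Rightarrow> real \<Rightarrow> real \<Rightarrow> real \<Rightarrow> nat \<Rightarrow> nat" where
  "rassg_iterations \<K> g G z \<theta> \<omega> w0 K D1 t1 \<epsilon>0 S =
     (case rassg_state \<K> g G z \<theta> \<omega> w0 K D1 t1 \<epsilon>0 S of (w, t, D, e, N) \<Rightarrow> N)"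

end

theory Submission
  imports Defs
begin

text \<open>
  Write \<open>F\<^sub>*\<close> for the optimal value and consider one stage, started at a centre \<open>c\<close> whose objective exceeds \<open>F\<^sub>* + \<tau>\<close> by at most \<open>e\<close>. By
  convexity the \<open>\<tau>\<close>-level can be reached from \<open>c\<close> within distance \<open>B * e / \<tau>\<close>, where \<open>B\<close> bounds the distance
  from the level set to the optimal set (\<open>level_point\<close>). So a ball of radius \<open>D \<ge> B * e / \<tau>\<close> around \<open>c\<close>
  contains a point \<open>v\<close> with \<open>F v \<le> F\<^sub>* + \<tau>\<close>. Projected subgradient steps of size \<open>e / (3 * G\<^sup>2)\<close> on this ball
  have average regret at most \<open>e / 3\<close> against \<open>v\<close>, once their number \<open>t\<close> exceeds \<open>9 * (G * D / e)\<^sup>2\<close>. What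
  remains is noise with nonpositive conditional mean and range of order \<open>G * D\<close>, whose average exceeds
  \<open>e / 6\<close> with small probability by Hoeffding's lemma and a Chernoff bound. Hence a stage halves the
  excess \<open>e\<close> with high probability (\<open>stage_failure_prob\<close>). The next stage halves \<open>e\<close> and \<open>D\<close> together, so
  the length \<open>t\<close> remains sufficient, and after \<open>K\<close> stages the excess is at most \<open>\<epsilon>\<close>.

  The first radius is tuned to the target \<open>\<tau> = \<epsilon>1\<close>, which may be far above \<open>\<epsilon>\<close>. Doubling the radius for each
  call halves the target that the call can serve, provided the distance bound \<open>B\<close> of the level \<open>\<epsilon>1\<close> is
  also valid at lower levels. After \<open>log 2 (\<epsilon>1 / \<epsilon>)\<close> doublings, rounded up, the target is \<open>\<epsilon>\<close> and the last
  call ends within \<open>\<epsilon> + \<epsilon>\<close> of the optimum (\<open>stage_point_failure_prob\<close>). At most \<open>K * K\<close> stages occur in total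
  and each fails with probability at most \<open>\<delta> / (K * (K + 1))\<close>, so a union bound gives \<open>\<delta>\<close>. The call lengths grow by the factor \<open>4\<close>, so the last
  call determines the order of the iteration count (\<open>iteration_bound\<close>).

  The centre of a stage is random and the ball around it moves with it. The bound for a fixed centre is
  integrated over the law of the centre, which is independent of the samples of the stage
  (\<open>random_centre_stage_failure_prob\<close>). Measurability of the iterates rests on the joint continuity of the
  projection in centre and argument (\<open>continuous_on_closest_point_ball_section\<close>).
\<close>

section \<open>Projection onto a ball section with a moving centre\<close>

text \<open>Add the two variational inequalities of the projections, each tested with a point of its set
  that lies within \<open>h\<close> of the other projection. Only Hoelder-1/2 dependence on \<open>h\<close> comes out, which is
  enough for continuity.\<close>

lemma closest_point_perturbed_set:
  fixes A A' :: "'a::euclidean_space set"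
  assumes A: "convex A" "closed A" and A': "convex A'" "closed A'"
    and near: "\<exists>u\<in>A. dist u (closest_point A' x) \<le> h"
    and near': "\<exists>u\<in>A'. dist u (closest_point A x) \<le> h"
  shows "(dist (closest_point A x) (closest_point A' x))\<^sup>2
    \<le> h * (2 * dist x (closest_point A x) + h)"
proof -
  define p where "p = closest_point A x"
  define p' where "p' = closest_point A' x"
  obtain u where u: "u \<in> A" "dist u p' \<le> h" using near p'_def by auto
  obtain u' where u': "u' \<in> A'" "dist u' p \<le> h" using near' p_def by auto
  have h: "0 \<le> h" using u(2) zero_le_dist[of u p'] by linarith
  have 1: "(x - p) \<bullet> (u - p) \<le> 0"
    unfolding p_def by (rule closest_point_dot) (use A u in auto)
  have 2: "(x - p') \<bullet> (u' - p') \<le> 0"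
    unfolding p'_def by (rule closest_point_dot) (use A' u' in auto)
  have cs1: "(x - p) \<bullet> (p' - u) \<le> h * norm (x - p)"
    using norm_cauchy_schwarz[of "x - p" "p' - u"] u(2) mult_left_mono[OF u(2), of "norm (x - p)"]
    by (simp add: dist_norm norm_minus_commute mult.commute)
  have cs2: "(x - p') \<bullet> (p - u') \<le> h * norm (x - p')"
    using norm_cauchy_schwarz[of "x - p'" "p - u'"] mult_left_mono[OF u'(2), of "norm (x - p')"]
    by (simp add: dist_norm norm_minus_commute mult.commute)
  have "dist x p' \<le> dist x u'"
    unfolding p'_def using A' u' by (intro closest_point_le)
  also have "\<dots> \<le> dist x p + h"
    using u'(2) dist_triangle[of x u' p] by (simp add: dist_commute)
  finally have d: "norm (x - p') \<le> norm (x - p) + h" by (simp add: dist_norm)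
  have "(norm (p - p'))\<^sup>2 = (x - p) \<bullet> (p' - p) + (x - p') \<bullet> (p - p')"
    unfolding power2_norm_eq_inner by (simp add: inner_diff algebra_simps inner_commute)
  also have "(x - p) \<bullet> (p' - p) \<le> (x - p) \<bullet> (p' - u)"
    using 1 by (simp add: inner_diff algebra_simps)
  also have "(x - p') \<bullet> (p - p') \<le> (x - p') \<bullet> (p - u')"
    using 2 by (simp add: inner_diff algebra_simps)
  finally have "(norm (p - p'))\<^sup>2 \<le> h * norm (x - p) + h * norm (x - p')"
    using cs1 cs2 by linarith
  also have "\<dots> \<le> h * norm (x - p) + h * (norm (x - p) + h)"
    using d h by (intro add_left_mono mult_left_mono)
  finally show ?thesis
    unfolding p_def[symmetric] p'_def[symmetric] by (simp add: dist_norm algebra_simps)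
qed

text \<open>Shrinking \<open>u\<close> towards the new centre \<open>c'\<close> by the factor \<open>D / (D + dist c c')\<close> brings it into the
  new ball and, by convexity, keeps it in \<open>\<K>\<close>. So the feasible region of a stage moves by at most
  as much as its centre, in the Hausdorff metric.\<close>

lemma ball_section_near:
  fixes \<K> :: "'a::euclidean_space set"
  assumes "convex \<K>" and c: "c' \<in> \<K>" and D: "0 < D" and u: "u \<in> \<K> \<inter> cball c D"
  shows "\<exists>u'\<in>\<K> \<inter> cball c' D. dist u' u \<le> dist c c'"
proof
  define h where "h = dist c c'"
  define a where "a = h / (D + h)"
  have h: "0 \<le> h" by (simp add: h_def)
  have a: "0 \<le> a" "a \<le> 1" "a * (D + h) = h" "(1 - a) * (D + h) = D"
    using D h by (auto simp: a_def field_simps)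
  have uc: "norm (u - c') \<le> D + h"
    using u dist_triangle[of u c' c] by (simp add: h_def dist_norm norm_minus_commute)
  let ?u' = "(1 - a) *\<^sub>R u + a *\<^sub>R c'"
  have "?u' - c' = (1 - a) *\<^sub>R (u - c')" by (simp add: algebra_simps)
  then have "dist ?u' c' = (1 - a) * norm (u - c')"
    unfolding dist_norm using a by simp
  also have "\<dots> \<le> D" using mult_left_mono[OF uc, of "1 - a"] a by simp
  finally have "?u' \<in> cball c' D" by (simp add: dist_commute)
  moreover have "?u' \<in> \<K>" using assms a by (intro convexD_alt) auto
  ultimately show "?u' \<in> \<K> \<inter> cball c' D" by simp
  have "?u' - u = a *\<^sub>R (c' - u)" by (simp add: algebra_simps)
  then have "dist ?u' u = a * norm (u - c')"
    unfolding dist_norm using a by (simp add: norm_minus_commute)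
  also have "\<dots> \<le> h" using mult_left_mono[OF uc, of a] a by simp
  finally show "dist ?u' u \<le> dist c c'" by (simp add: h_def)
qed

text \<open>The centre of a stage is the random output of the previous stage, so measurability of the iterates
  requires the projection to be jointly measurable in the centre and the projected point. Joint
  continuity gives this.\<close>

lemma continuous_on_closest_point_ball_section:
  fixes \<K> :: "'a::euclidean_space set"
  assumes \<K>: "closed \<K>" "convex \<K>" and D: "0 < D"
  shows "continuous_on (\<K> \<times> UNIV) (\<lambda>(c, x). closest_point (\<K> \<inter> cball c D) x)"
proof -
  let ?\<phi> = "\<lambda>c x. closest_point (\<K> \<inter> cball c D) x"
  have set: "convex (\<K> \<inter> cball c D)" "closed (\<K> \<inter> cball c D)" for c
    using \<K> by (auto simp: convex_Int closed_Int)
  have in_set: "?\<phi> c x \<in> \<K> \<inter> cball c D" if "c \<in> \<K>" for c x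
    using that D by (intro closest_point_in_set set(2)) (auto simp: less_imp_le)
  have bound: "dist (?\<phi> c' x') (?\<phi> c x)
      \<le> dist x' x + sqrt (dist c' c * (2 * dist x (?\<phi> c x) + dist c' c))"
    if c: "c \<in> \<K>" "c' \<in> \<K>" for c c' x x'
  proof -
    have "dist (?\<phi> c' x') (?\<phi> c' x) \<le> dist x' x"
      using that D by (intro closest_point_lipschitz set) (auto intro!: exI[of _ c'])
    moreover have "(dist (?\<phi> c x) (?\<phi> c' x))\<^sup>2 \<le> dist c' c * (2 * dist x (?\<phi> c x) + dist c' c)"
      using ball_section_near[OF \<K>(2) c(1) D in_set[OF c(2)], of x]
        ball_section_near[OF \<K>(2) c(2) D in_set[OF c(1)], of x]
      by (intro closest_point_perturbed_set set) (auto simp: dist_commute)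
    then have "dist (?\<phi> c x) (?\<phi> c' x) \<le> sqrt (dist c' c * (2 * dist x (?\<phi> c x) + dist c' c))"
      using real_le_rsqrt by blast
    ultimately show ?thesis
      using dist_triangle[of "?\<phi> c' x'" "?\<phi> c x" "?\<phi> c' x"] by (simp add: dist_commute)
  qed
  show ?thesis
    unfolding continuous_on_def
  proof
    fix y :: "'a \<times> 'a" assume y: "y \<in> \<K> \<times> UNIV"
    obtain c x where cx: "y = (c, x)" "c \<in> \<K>" using y by auto
    have fst: "((\<lambda>q. dist (fst q) c) \<longlongrightarrow> dist c c) (at y within \<K> \<times> UNIV)"
      unfolding cx by (intro tendsto_intros tendsto_fst[of _ "(c, x)", simplified])
    have snd: "((\<lambda>q. dist (snd q) x) \<longlongrightarrow> dist x x) (at y within \<K> \<times> UNIV)"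
      unfolding cx by (intro tendsto_intros tendsto_snd[of _ "(c, x)", simplified])
    let ?b = "\<lambda>q. dist (snd q) x + sqrt (dist (fst q) c * (2 * dist x (?\<phi> c x) + dist (fst q) c))"
    have "(?b \<longlongrightarrow> dist x x + sqrt (dist c c * (2 * dist x (?\<phi> c x) + dist c c))) (at y within \<K> \<times> UNIV)"
      by (intro tendsto_intros fst snd)
    then have b: "(?b \<longlongrightarrow> 0) (at y within \<K> \<times> UNIV)" by simp
    have "((\<lambda>q. dist (case q of (c, x) \<Rightarrow> ?\<phi> c x) (?\<phi> c x)) \<longlongrightarrow> 0) (at y within \<K> \<times> UNIV)"
    proof (rule tendsto_sandwich[OF _ _ tendsto_const b])
      show "\<forall>\<^sub>F q in at y within \<K> \<times> UNIV. dist (case q of (c, x) \<Rightarrow> ?\<phi> c x) (?\<phi> c x) \<le> ?b q"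
        unfolding eventually_at_filter using cx bound by (auto intro!: always_eventually)
    qed auto
    then show "((\<lambda>(c, x). ?\<phi> c x) \<longlongrightarrow> (case y of (c, x) \<Rightarrow> ?\<phi> c x)) (at y within \<K> \<times> UNIV)"
      by (simp add: cx tendsto_dist_iff[symmetric])
  qed
qed

section \<open>The objective and its level sets\<close>

locale stochastic_subgradient =
  fixes \<K> :: "'a::euclidean_space set"
    and P :: "'z measure"
    and f :: "'a \<Rightarrow> 'z \<Rightarrow> real"
    and g :: "'a \<Rightarrow> 'z \<Rightarrow> 'a"
    and F :: "'a \<Rightarrow> real"
    and G :: real
  assumes K_closed: "closed \<K>" and K_convex: "convex \<K>"
    and P_prob: "prob_space P"
    and f_convex: "\<And>z. z \<in> space P \<Longrightarrow> convex_on UNIV (\<lambda>w. f w z)"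
    and f_integrable: "\<And>w. w \<in> \<K> \<Longrightarrow> integrable P (f w)"
    and F_eq: "F = objective P f"
    and optimum_exists: "opt_set F \<K> \<noteq> {}"
    and subgradient: "\<And>w z. w \<in> \<K> \<Longrightarrow> z \<in> space P \<Longrightarrow> g w z \<in> subdifferential (\<lambda>u. f u z) w"
    and g_measurable: "(\<lambda>(w, z). g w z) \<in> borel_measurable (borel \<Otimes>\<^sub>M P)"
    and G_pos: "0 < G"
    and g_bound: "\<And>w z. w \<in> \<K> \<Longrightarrow> z \<in> space P \<Longrightarrow> norm (g w z) \<le> G"
begin

sublocale P: prob_space P by (rule P_prob)

lemma subgradient_ineq: "w \<in> \<K> \<Longrightarrow> z \<in> space P \<Longrightarrow> f w z + g w z \<bullet> (u - w) \<le> f u z"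
  using subgradient[of w z] by (auto simp: subdifferential_def)

lemma F_convex: "convex_on \<K> F"
proof (rule convex_onI)
  fix a :: real and x y assume a: "0 < a" "a < 1" and xy: "x \<in> \<K>" "y \<in> \<K>"
  let ?m = "(1 - a) *\<^sub>R x + a *\<^sub>R y"
  have m: "?m \<in> \<K>" using a xy K_convex by (intro convexD_alt) auto
  have "F ?m \<le> (\<integral>z. (1 - a) * f x z + a * f y z \<partial>P)"
    unfolding F_eq objective_def
    using f_integrable m xy a convex_onD[OF f_convex, of _ a x y]
    by (intro integral_mono Bochner_Integration.integrable_add) auto
  also have "\<dots> = (1 - a) * F x + a * F y"
    unfolding F_eq objective_def using f_integrable xy by simp
  finally show "F ?m \<le> (1 - a) * F x + a * F y" .
qed (rule K_convex)

lemma F_lipschitz_le: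
  assumes "w \<in> \<K>" "u \<in> \<K>"
  shows "F w - F u \<le> G * dist w u"
proof -
  have "f w z - f u z \<le> G * dist w u" if z: "z \<in> space P" for z
  proof -
    have "f w z - f u z \<le> g w z \<bullet> (w - u)"
      using subgradient_ineq[OF assms(1) z, of u] by (simp add: inner_diff)
    also have "\<dots> \<le> norm (g w z) * norm (w - u)" by (rule norm_cauchy_schwarz)
    also have "\<dots> \<le> G * norm (w - u)" using g_bound[OF assms(1) z] by (intro mult_right_mono) auto
    finally show ?thesis by (simp add: dist_norm)
  qed
  then have "(\<integral>z. f w z - f u z \<partial>P) \<le> (\<integral>z. G * dist w u \<partial>P)"
    using f_integrable assms by (intro integral_mono) auto
  then show ?thesis
    unfolding F_eq objective_def using f_integrable assms by (simp add: P.prob_space)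
qed

lemma F_continuous: "continuous_on \<K> F"
proof -
  have "G-lipschitz_on \<K> F"
    using F_lipschitz_le G_pos
    by (intro lipschitz_onI) (auto simp: dist_real_def abs_le_iff, metis dist_commute)
  then show ?thesis by (rule lipschitz_on_continuous_on)
qed

lemma opt_value_eq:
  assumes "u \<in> opt_set F \<K>"
  shows "F u = opt_value F \<K>"
proof -
  have u: "u \<in> \<K>" and le: "\<And>w. w \<in> \<K> \<Longrightarrow> F u \<le> F w"
    using assms by (auto simp: opt_set_def is_arg_min_linorder)
  show ?thesis
    unfolding opt_value_def
  proof (rule antisym)
    show "F u \<le> (INF w\<in>\<K>. F w)" using u le by (intro cINF_greatest) auto
    show "(INF w\<in>\<K>. F w) \<le> F u" using u le by (intro cINF_lower bdd_belowI2) auto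
  qed
qed

lemma opt_value_le:
  assumes "w \<in> \<K>"
  shows "opt_value F \<K> \<le> F w"
proof -
  obtain u where u: "u \<in> opt_set F \<K>" using optimum_exists by auto
  then have "F u \<le> F w" using assms by (auto simp: opt_set_def is_arg_min_linorder)
  then show ?thesis using opt_value_eq[OF u] by simp
qed

lemma opt_set_eq: "opt_set F \<K> = {w \<in> \<K>. F w \<le> opt_value F \<K>}"
proof (intro set_eqI iffI)
  fix u assume u: "u \<in> opt_set F \<K>"
  then show "u \<in> {w \<in> \<K>. F w \<le> opt_value F \<K>}"
    using opt_value_eq[OF u] by (simp add: opt_set_def is_arg_min_linorder)
next
  fix u assume "u \<in> {w \<in> \<K>. F w \<le> opt_value F \<K>}"
  then show "u \<in> opt_set F \<K>"
    using opt_value_le order_trans by (auto simp: opt_set_def is_arg_min_linorder)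
qed

lemma opt_set_closed: "closed (opt_set F \<K>)"
  unfolding opt_set_eq
  using continuous_closed_preimage[OF F_continuous K_closed, of "{..opt_value F \<K>}"]
  by (simp add: vimage_def Int_def)

text \<open>The Lipschitz bound forces the level set away from the optimal set. This makes the radii
  positive and the first stage length at least \<open>9\<close>, so that rounding up lengths costs only a
  constant factor.\<close>

lemma level_dist_ge:
  assumes "0 \<le> e" "level_set F \<K> e \<noteq> {}"
    and "bdd_above ((\<lambda>w. infdist w (opt_set F \<K>)) ` level_set F \<K> e)"
  shows "e / G \<le> level_dist F \<K> e"
proof -
  obtain w where w: "w \<in> level_set F \<K> e" using assms by auto
  obtain u where u: "u \<in> opt_set F \<K>" and wu: "infdist w (opt_set F \<K>) = dist w u"
    using infdist_attains_inf[OF opt_set_closed optimum_exists] by metis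
  have "e \<le> G * dist w u"
    using F_lipschitz_le[of w u] w u opt_value_eq[OF u] by (auto simp: level_set_def opt_set_eq)
  also have "dist w u = infdist w (opt_set F \<K>)"
    using wu by simp
  also have "\<dots> \<le> level_dist F \<K> e"
    unfolding level_dist_def using assms w by (intro cSUP_upper)
  finally show ?thesis using G_pos by (simp add: field_simps)
qed

text \<open>The error bound behind the restarts: the distance from \<open>c\<close> to the \<open>\<tau>\<close>-level is at most
  proportional to the objective gap. Project \<open>c\<close> to the optimal set and take \<open>v\<close> where the segment
  crosses the level. Convexity along the segment compares its two pieces, and the piece beyond \<open>v\<close> has
  length \<open>infdist v (opt_set F \<K>)\<close>.\<close>

lemma level_point:
  assumes c: "c \<in> \<K>" and \<tau>: "0 < \<tau>" and gap: "opt_value F \<K> + \<tau> \<le> F c"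
  obtains v where "v \<in> level_set F \<K> \<tau>"
    "\<tau> * dist c v \<le> infdist v (opt_set F \<K>) * (F c - opt_value F \<K> - \<tau>)"
proof -
  define u where "u = closest_point (opt_set F \<K>) c"
  have u: "u \<in> opt_set F \<K>"
    unfolding u_def by (intro closest_point_in_set opt_set_closed optimum_exists)
  then have uK: "u \<in> \<K>" by (simp add: opt_set_eq)
  have Fu: "F u = opt_value F \<K>" by (rule opt_value_eq[OF u])
  define q where "q = (\<lambda>s. (1 - s) *\<^sub>R c + s *\<^sub>R u)"
  have qK: "q s \<in> \<K>" if "0 \<le> s" "s \<le> 1" for s
    unfolding q_def using K_convex c uK that by (intro convexD_alt) auto
  have "continuous_on {0..1} (\<lambda>s. F (q s))"
  proof (rule continuous_on_compose2[OF F_continuous])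
    show "continuous_on {0..1} q" unfolding q_def by (intro continuous_intros)
  qed (use qK in auto)
  then have "\<exists>s. 0 \<le> s \<and> s \<le> 1 \<and> F (q s) = opt_value F \<K> + \<tau>"
    using gap \<tau> Fu by (intro IVT2') (auto simp: q_def)
  then obtain s where s: "0 \<le> s" "s \<le> 1" and Fq: "F (q s) = opt_value F \<K> + \<tau>" by auto
  have "F (q s) \<le> (1 - s) * F c + s * F u"
    unfolding q_def using s c uK by (intro convex_onD[OF F_convex])
  then have \<tau>_le: "\<tau> \<le> (1 - s) * (F c - opt_value F \<K>)"
    using Fq Fu by (simp add: algebra_simps)
  have cq: "dist c (q s) = s * dist c u"
  proof -
    have "c - q s = s *\<^sub>R (c - u)" by (simp add: q_def algebra_simps)
    then show ?thesis using s by (simp add: dist_norm)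
  qed
  have qu: "dist (q s) u = (1 - s) * dist c u"
  proof -
    have "q s - u = (1 - s) *\<^sub>R (c - u)" by (simp add: q_def algebra_simps)
    then show ?thesis using s by (simp add: dist_norm)
  qed
  \<comment> \<open>\<open>u\<close> remains a nearest optimum for every point of the segment from \<open>c\<close> to \<open>u\<close>\<close>
  have "(1 - s) * dist c u \<le> infdist (q s) (opt_set F \<K>)"
    unfolding infdist_notempty[OF optimum_exists]
  proof (rule cINF_greatest[OF optimum_exists])
    fix o' assume "o' \<in> opt_set F \<K>"
    then have "dist c u \<le> dist c o'" unfolding u_def by (intro closest_point_le opt_set_closed)
    also have "\<dots> \<le> s * dist c u + dist (q s) o'" using dist_triangle[of c o' "q s"] cq by simp
    finally show "(1 - s) * dist c u \<le> dist (q s) o'" by (simp add: algebra_simps)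
  qed
  moreover have "0 \<le> F c - opt_value F \<K> - \<tau>" using gap by simp
  ultimately have "(1 - s) * dist c u * (F c - opt_value F \<K> - \<tau>)
      \<le> infdist (q s) (opt_set F \<K>) * (F c - opt_value F \<K> - \<tau>)"
    by (intro mult_right_mono)
  moreover have "\<tau> * (s * dist c u) \<le> (1 - s) * dist c u * (F c - opt_value F \<K> - \<tau>)"
  proof -
    have "\<tau> \<le> (1 - s) * (F c - opt_value F \<K> - \<tau>) + (1 - s) * \<tau>"
      using \<tau>_le by (simp add: algebra_simps)
    then have "\<tau> * s \<le> (1 - s) * (F c - opt_value F \<K> - \<tau>)" by (simp add: algebra_simps)
    then have "\<tau> * s * dist c u \<le> (1 - s) * (F c - opt_value F \<K> - \<tau>) * dist c u"
      by (rule mult_right_mono) simp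
    then show ?thesis by (simp only: mult_ac)
  qed
  ultimately have "\<tau> * dist c (q s) \<le> infdist (q s) (opt_set F \<K>) * (F c - opt_value F \<K> - \<tau>)"
    using cq by simp
  moreover have "q s \<in> level_set F \<K> \<tau>" using qK[OF s] Fq by (simp add: level_set_def)
  ultimately show ?thesis by (rule that[rotated])
qed

end



lemma borel_measurable_compose_continuous_on:
  fixes h :: "'b::topological_space \<Rightarrow> 'c::topological_space"
  assumes "continuous_on A h" "X \<in> borel_measurable N" "\<And>x. x \<in> space N \<Longrightarrow> X x \<in> A"
  shows "(\<lambda>x. h (X x)) \<in> borel_measurable N"
  using assms
  by (intro measurable_compose[OF _ borel_measurable_continuous_on_restrict[OF assms(1)]]
        measurable_restrict_space2) auto

lemma sgd_iterate_cong:
  "(\<And>i. i < j \<Longrightarrow> z i = z' i) \<Longrightarrow> sgd_iterate \<K> g \<eta> c D z j = sgd_iterate \<K> g \<eta> c D z' j"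
  by (induction j) (simp_all add: Let_def)

lemma sgd_average_cong:
  assumes "\<And>i. i < t \<Longrightarrow> z i = z' i"
  shows "sgd_average \<K> g \<eta> c D z t = sgd_average \<K> g \<eta> c D z' t"
  unfolding sgd_average_def
  using sgd_iterate_cong[of _ z z' \<K> g \<eta> c D] assms by (auto intro!: sum.cong)

context stochastic_subgradient
begin

section \<open>One stage with a fixed centre\<close>

lemma sgd_iterate_in:
  assumes "c \<in> \<K>" "0 \<le> D"
  shows "sgd_iterate \<K> g \<eta> c D z j \<in> \<K> \<inter> cball c D"
proof (cases j)
  case (Suc i)
  show ?thesis
    unfolding Suc sgd_iterate.simps Let_def
    using assms K_closed by (intro closest_point_in_set closed_Int closed_cball) auto
qed (use assms in auto)

lemma sgd_average_in:
  assumes "c \<in> \<K>" "0 \<le> D" "0 < t"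
  shows "sgd_average \<K> g \<eta> c D z t \<in> \<K>"
proof -
  have "(\<Sum>j<t. (1 / real t) *\<^sub>R sgd_iterate \<K> g \<eta> c D z j) \<in> \<K>"
    using assms sgd_iterate_in[of c D] K_convex by (intro convex_sum) auto
  then show ?thesis unfolding sgd_average_def by (simp add: scaleR_sum_right)
qed

text \<open>The usual potential argument: projecting to a convex set that contains \<open>v\<close> does not increase the
  distance to \<open>v\<close>, and expanding the square makes the sum telescope. The sum includes the
  subgradient at the last averaged iterate, whose step the algorithm never takes.\<close>

lemma sgd_regret:
  fixes \<eta> c D z defines "w \<equiv> sgd_iterate \<K> g \<eta> c D z"
  assumes c: "c \<in> \<K>" and D: "0 \<le> D" and v: "v \<in> \<K> \<inter> cball c D"
    and \<eta>: "0 \<le> \<eta>" and z: "\<And>j. j < t \<Longrightarrow> z j \<in> space P"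
  shows "2 * \<eta> * (\<Sum>j<t. g (w j) (z j) \<bullet> (w j - v)) \<le> (dist c v)\<^sup>2 + real t * \<eta>\<^sup>2 * G\<^sup>2"
proof -
  have "2 * \<eta> * (\<Sum>j<t. g (w j) (z j) \<bullet> (w j - v)) + (dist (w t) v)\<^sup>2
      \<le> (dist c v)\<^sup>2 + real t * \<eta>\<^sup>2 * G\<^sup>2"
    using z
  proof (induction t)
    case (Suc t)
    let ?g = "g (w t) (z t)" and ?C = "\<K> \<inter> cball c D"
    have C: "convex ?C" "closed ?C" "?C \<noteq> {}"
      using K_convex K_closed v by (auto simp: convex_Int closed_Int)
    have wt: "w t \<in> \<K>" unfolding w_def using sgd_iterate_in[OF c D] by auto
    have "dist (w (Suc t)) v \<le> dist (w t - \<eta> *\<^sub>R ?g) v"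
      using closest_point_lipschitz[OF C, of "w t - \<eta> *\<^sub>R ?g" v] v
      by (auto simp: w_def Let_def closest_point_self)
    then have "(dist (w (Suc t)) v)\<^sup>2 \<le> (dist (w t - \<eta> *\<^sub>R ?g) v)\<^sup>2"
      by (intro power_mono) auto
    also have "\<dots> = (dist (w t) v)\<^sup>2 - 2 * \<eta> * (?g \<bullet> (w t - v)) + \<eta>\<^sup>2 * (norm ?g)\<^sup>2"
      unfolding dist_norm power2_norm_eq_inner
      by (simp add: inner_diff inner_commute algebra_simps power2_eq_square)
    also have "\<eta>\<^sup>2 * (norm ?g)\<^sup>2 \<le> \<eta>\<^sup>2 * G\<^sup>2"
      using g_bound[OF wt Suc.prems[of t]] by (intro mult_left_mono power_mono) auto
    finally show ?case using Suc by (simp add: algebra_simps)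
  qed (simp add: w_def)
  then show ?thesis using zero_le_power2[of "dist (w t) v"] by linarith
qed

text \<open>The error of replacing the gap \<open>F w - F v\<close> by the observed linearisation. For \<open>v\<close> and
  \<open>w\<close> in \<open>\<K>\<close> its mean is at most \<open>0\<close>, as one sees by integrating the subgradient inequality of \<open>f\<close>.\<close>

definition noise :: "'a \<Rightarrow> 'a \<Rightarrow> 'z \<Rightarrow> real" where
  "noise v w z = F w - F v - g w z \<bullet> (w - v)"

lemma g_comp_measurable:
  assumes "X \<in> borel_measurable N" "\<zeta> \<in> N \<rightarrow>\<^sub>M P"
  shows "(\<lambda>x. g (X x) (\<zeta> x)) \<in> borel_measurable N"
  using measurable_compose[OF measurable_Pair[OF assms] g_measurable] by simp

text \<open>Hoeffding's lemma for the inner product, which lies in an interval of length \<open>2 * G * R\<close>; the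
  nonpositive mean of the noise only helps.\<close>

lemma noise_mgf:
  assumes w: "w \<in> \<K>" and v: "v \<in> \<K>" and R: "dist w v \<le> R" and \<alpha>: "0 < \<alpha>"
  shows "(\<integral>\<^sup>+z. ennreal (exp (\<alpha> * noise v w z)) \<partial>P) \<le> ennreal (exp (\<alpha>\<^sup>2 * G\<^sup>2 * R\<^sup>2 / 2))"
proof -
  define X where "X = (\<lambda>z. - (g w z \<bullet> (w - v)))"
  have [measurable]: "X \<in> borel_measurable P"
    unfolding X_def using g_comp_measurable[of "\<lambda>_. w" P "\<lambda>z. z"] by simp
  have X_bound: "\<bar>X z\<bar> \<le> G * R" if "z \<in> space P" for z
  proof -
    have "\<bar>X z\<bar> \<le> norm (g w z) * norm (w - v)"
      unfolding X_def abs_minus_cancel by (rule Cauchy_Schwarz_ineq2)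
    also have "\<dots> \<le> G * R"
      using g_bound[OF w that] R G_pos by (intro mult_mono) (auto simp: dist_norm)
    finally show ?thesis .
  qed
  interpret X: interval_bounded_random_variable P X "- (G * R)" "G * R"
  proof
    show "AE z in P. X z \<in> {- (G * R)..G * R}" using X_bound by (intro AE_I2) force
  qed measurable
  have drift: "F w - F v + P.expectation X \<le> 0"
  proof -
    have "F w - F v + P.expectation X = (\<integral>z. f w z - f v z + X z \<partial>P)"
      unfolding F_eq objective_def using f_integrable w v X.integrable by simp
    also have "\<dots> \<le> (\<integral>z. 0 \<partial>P)"
    proof (rule integral_mono)
      show "integrable P (\<lambda>z. f w z - f v z + X z)" using f_integrable w v X.integrable by simp
      show "f w z - f v z + X z \<le> 0" if "z \<in> space P" for z
        using subgradient_ineq[OF w that, of v] by (simp add: X_def inner_diff)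
    qed simp
    finally show ?thesis by simp
  qed
  have "(\<integral>\<^sup>+z. ennreal (exp (\<alpha> * noise v w z)) \<partial>P)
      \<le> (\<integral>\<^sup>+z. ennreal (exp (\<alpha> * (X z - P.expectation X))) \<partial>P)"
  proof (intro nn_integral_mono ennreal_leI)
    fix z
    have "noise v w z \<le> X z - P.expectation X"
      using drift by (simp add: noise_def X_def)
    then show "exp (\<alpha> * noise v w z) \<le> exp (\<alpha> * (X z - P.expectation X))"
      using \<alpha> by simp
  qed
  also have "\<dots> \<le> ennreal (exp (\<alpha>\<^sup>2 * (G * R - - (G * R))\<^sup>2 / 8))"
    by (rule X.Hoeffdings_lemma_nn_integral[OF \<alpha>])
  also have "\<alpha>\<^sup>2 * (G * R - - (G * R))\<^sup>2 / 8 = \<alpha>\<^sup>2 * G\<^sup>2 * R\<^sup>2 / 2"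
    by (simp add: power2_eq_square)
  finally show ?thesis .
qed

lemma sgd_iterate_measurable:
  assumes D: "0 < D" and c: "c \<in> borel_measurable N" "\<And>x. x \<in> space N \<Longrightarrow> c x \<in> \<K>"
    and \<zeta>: "\<And>i. i < j \<Longrightarrow> \<zeta> i \<in> N \<rightarrow>\<^sub>M P"
  shows "(\<lambda>x. sgd_iterate \<K> g \<eta> (c x) D (\<lambda>i. \<zeta> i x) j) \<in> borel_measurable N"
  using \<zeta>
proof (induction j)
  case (Suc j)
  let ?w = "\<lambda>x. sgd_iterate \<K> g \<eta> (c x) D (\<lambda>i. \<zeta> i x) j"
  let ?y = "\<lambda>x. ?w x - \<eta> *\<^sub>R g (?w x) (\<zeta> j x)"
  have [measurable]: "?w \<in> borel_measurable N" using Suc by simp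
  have [measurable]: "(\<lambda>x. g (?w x) (\<zeta> j x)) \<in> borel_measurable N"
    using Suc.prems by (intro g_comp_measurable) auto
  have "(\<lambda>x. (\<lambda>(c, y). closest_point (\<K> \<inter> cball c D) y) (c x, ?y x)) \<in> borel_measurable N"
    using c(2)
    by (intro borel_measurable_compose_continuous_on
          [OF continuous_on_closest_point_ball_section[OF K_closed K_convex D]]
        borel_measurable_Pair c(1)) auto
  then show ?case by (simp add: Let_def)
qed (simp add: c)

lemma sgd_average_measurable:
  assumes "0 < D" "c \<in> borel_measurable N" "\<And>x. x \<in> space N \<Longrightarrow> c x \<in> \<K>"
    and "\<And>i. i < t \<Longrightarrow> \<zeta> i \<in> N \<rightarrow>\<^sub>M P"
  shows "(\<lambda>x. sgd_average \<K> g \<eta> (c x) D (\<lambda>i. \<zeta> i x) t) \<in> borel_measurable N"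
  unfolding sgd_average_def
  using assms
  by (intro borel_measurable_scaleR borel_measurable_sum sgd_iterate_measurable) auto

lemma F_comp_measurable:
  assumes "X \<in> borel_measurable N" "\<And>x. x \<in> space N \<Longrightarrow> X x \<in> \<K>"
  shows "(\<lambda>x. F (X x)) \<in> borel_measurable N"
  using assms by (rule borel_measurable_compose_continuous_on[OF F_continuous])

lemma cumulative_noise_measurable:
  assumes c: "c \<in> \<K>" and D: "0 < D"
  shows "(\<lambda>z. \<Sum>j<t. noise v (sgd_iterate \<K> g \<eta> c D z j) (z j))
    \<in> borel_measurable (\<Pi>\<^sub>M j\<in>{..<t}. P)"
proof (intro borel_measurable_sum)
  fix j assume j: "j \<in> {..<t}"
  let ?N = "\<Pi>\<^sub>M j\<in>{..<t}. P"
  have coord: "(\<lambda>z. z i) \<in> ?N \<rightarrow>\<^sub>M P" if "i < t" for i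
    using that by simp
  have [measurable]: "(\<lambda>z. sgd_iterate \<K> g \<eta> c D z j) \<in> borel_measurable ?N"
    using sgd_iterate_measurable[of D "\<lambda>_. c" ?N j "\<lambda>i z. z i"] c D coord j by simp
  then have [measurable]: "(\<lambda>z. g (sgd_iterate \<K> g \<eta> c D z j) (z j)) \<in> borel_measurable ?N"
    using coord j by (intro g_comp_measurable) auto
  have [measurable]: "(\<lambda>z. F (sgd_iterate \<K> g \<eta> c D z j)) \<in> borel_measurable ?N"
    using sgd_iterate_in[OF c, of D] D by (intro F_comp_measurable) auto
  show "(\<lambda>z. noise v (sgd_iterate \<K> g \<eta> c D z j) (z j)) \<in> borel_measurable ?N"
    unfolding noise_def by measurable
qed

text \<open>Integrate out the last sample first: the iterates and the earlier noise terms do not depend on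
  it, and the iterate is within \<open>2 * D\<close> of \<open>v\<close>. The bound for a single step thus multiplies up, which is
  Azuma's argument written with Fubini instead of conditional expectations.\<close>

lemma cumulative_noise_mgf:
  assumes c: "c \<in> \<K>" and D: "0 < D" and v: "v \<in> \<K> \<inter> cball c D" and \<alpha>: "0 < \<alpha>"
  shows "(\<integral>\<^sup>+z. ennreal (exp (\<alpha> * (\<Sum>j<t. noise v (sgd_iterate \<K> g \<eta> c D z j) (z j))))
      \<partial>(\<Pi>\<^sub>M j\<in>{..<t}. P)) \<le> ennreal (exp (real t * (2 * \<alpha>\<^sup>2 * G\<^sup>2 * D\<^sup>2)))"
proof (induction t)
  interpret product_sigma_finite "\<lambda>_. P" by standard
  case 0
  show ?case
    using prob_space.emeasure_space_1[OF prob_space_PiM[of "{} :: nat set" "\<lambda>_. P"]] P_prob by simp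
next
  interpret product_sigma_finite "\<lambda>_. P" by standard
  case (Suc t)
  let ?w = "\<lambda>z j. sgd_iterate \<K> g \<eta> c D z j"
  let ?S = "\<lambda>t z. \<Sum>j<t. noise v (?w z j) (z j)"
  have w_upd: "?w (z(t := y)) j = ?w z j" if "j \<le> t" for z y j
    using that by (intro sgd_iterate_cong) auto
  have S_upd: "?S (Suc t) (z(t := y)) = ?S t z + noise v (?w z t) y" for z y
    by (simp add: w_upd)
  have last: "(\<integral>\<^sup>+y. ennreal (exp (\<alpha> * noise v (?w z t) y)) \<partial>P)
      \<le> ennreal (exp (2 * \<alpha>\<^sup>2 * G\<^sup>2 * D\<^sup>2))" for z
  proof -
    have w: "?w z t \<in> \<K> \<inter> cball c D" using sgd_iterate_in[OF c] D by simp
    have "dist (?w z t) v \<le> 2 * D"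
      using w v dist_triangle[of "?w z t" v c] by (auto simp: dist_commute)
    then show ?thesis
      using noise_mgf[of "?w z t" v "2 * D" \<alpha>] w v \<alpha> by (simp add: power_mult_distrib mult_ac)
  qed
  have "(\<integral>\<^sup>+z. ennreal (exp (\<alpha> * ?S (Suc t) z)) \<partial>(\<Pi>\<^sub>M j\<in>insert t {..<t}. P))
      = (\<integral>\<^sup>+z. (\<integral>\<^sup>+y. ennreal (exp (\<alpha> * ?S (Suc t) (z(t := y)))) \<partial>P) \<partial>(\<Pi>\<^sub>M j\<in>{..<t}. P))"
    using cumulative_noise_measurable[OF c D, where t = "Suc t"]
    by (intro product_nn_integral_insert) (auto simp: lessThan_Suc[symmetric])
  also have "\<dots> = (\<integral>\<^sup>+z. (\<integral>\<^sup>+y. ennreal (exp (\<alpha> * ?S t z)) *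
        ennreal (exp (\<alpha> * noise v (?w z t) y)) \<partial>P) \<partial>(\<Pi>\<^sub>M j\<in>{..<t}. P))"
    unfolding S_upd by (simp add: distrib_left exp_add ennreal_mult)
  also have "\<dots> \<le> (\<integral>\<^sup>+z. ennreal (exp (\<alpha> * ?S t z)) * ennreal (exp (2 * \<alpha>\<^sup>2 * G\<^sup>2 * D\<^sup>2))
        \<partial>(\<Pi>\<^sub>M j\<in>{..<t}. P))"
  proof (rule nn_integral_mono)
    fix z
    have [measurable]: "(\<lambda>y. g (?w z t) y) \<in> borel_measurable P"
      using g_comp_measurable[of "\<lambda>_. ?w z t" P "\<lambda>z. z"] by simp
    have "(\<integral>\<^sup>+y. ennreal (exp (\<alpha> * ?S t z)) * ennreal (exp (\<alpha> * noise v (?w z t) y)) \<partial>P)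
        = ennreal (exp (\<alpha> * ?S t z)) * (\<integral>\<^sup>+y. ennreal (exp (\<alpha> * noise v (?w z t) y)) \<partial>P)"
      unfolding noise_def by (intro nn_integral_cmult) measurable
    also have "\<dots> \<le> ennreal (exp (\<alpha> * ?S t z)) * ennreal (exp (2 * \<alpha>\<^sup>2 * G\<^sup>2 * D\<^sup>2))"
      by (intro mult_left_mono last) auto
    finally show "(\<integral>\<^sup>+y. ennreal (exp (\<alpha> * ?S t z)) * ennreal (exp (\<alpha> * noise v (?w z t) y)) \<partial>P)
        \<le> ennreal (exp (\<alpha> * ?S t z)) * ennreal (exp (2 * \<alpha>\<^sup>2 * G\<^sup>2 * D\<^sup>2))" .
  qed
  also have "\<dots> = (\<integral>\<^sup>+z. ennreal (exp (\<alpha> * ?S t z)) \<partial>(\<Pi>\<^sub>M j\<in>{..<t}. P))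
      * ennreal (exp (2 * \<alpha>\<^sup>2 * G\<^sup>2 * D\<^sup>2))"
    using cumulative_noise_measurable[OF c D, where t = t] by (intro nn_integral_multc) auto
  also have "\<dots> \<le> ennreal (exp (real t * (2 * \<alpha>\<^sup>2 * G\<^sup>2 * D\<^sup>2))) * ennreal (exp (2 * \<alpha>\<^sup>2 * G\<^sup>2 * D\<^sup>2))"
    by (intro mult_right_mono Suc.IH) auto
  also have "\<dots> = ennreal (exp (real (Suc t) * (2 * \<alpha>\<^sup>2 * G\<^sup>2 * D\<^sup>2)))"
    by (simp add: ennreal_mult[symmetric] exp_add[symmetric] algebra_simps)
  finally show ?case by (simp add: lessThan_Suc)
qed

text \<open>The choice \<open>\<eta> = e / (3 * G\<^sup>2)\<close> and the lower bound on \<open>t\<close> make both deterministic terms of the regret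
  bound at most \<open>e / 6\<close> per iteration.\<close>

lemma sgd_average_gap:
  fixes c D z t e
  defines "\<eta> \<equiv> e / (3 * G\<^sup>2)"
  assumes c: "c \<in> \<K>" and D: "0 \<le> D" and v: "v \<in> \<K> \<inter> cball c D" and e: "0 < e"
    and t: "0 < t" "9 * (G * D / e)\<^sup>2 \<le> real t" and z: "\<And>j. j < t \<Longrightarrow> z j \<in> space P"
  shows "real t * (F (sgd_average \<K> g \<eta> c D z t) - F v)
    \<le> (\<Sum>j<t. noise v (sgd_iterate \<K> g \<eta> c D z j) (z j)) + real t * e / 3"
proof -
  define w where "w = sgd_iterate \<K> g \<eta> c D z"
  have \<eta>: "0 < \<eta>" using e G_pos by (simp add: \<eta>_def)
  have "F (\<Sum>j<t. (1 / real t) *\<^sub>R w j) \<le> (\<Sum>j<t. (1 / real t) * F (w j))"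
    using t sgd_iterate_in[OF c D] F_convex by (intro convex_on_sum) (auto simp: w_def)
  then have "F (sgd_average \<K> g \<eta> c D z t) \<le> (\<Sum>j<t. F (w j)) / real t"
    by (simp add: sgd_average_def w_def scaleR_sum_right sum_divide_distrib)
  then have "real t * F (sgd_average \<K> g \<eta> c D z t) \<le> (\<Sum>j<t. F (w j))"
    using t by (simp add: field_simps)
  then have "real t * (F (sgd_average \<K> g \<eta> c D z t) - F v) \<le> (\<Sum>j<t. F (w j) - F v)"
    by (simp add: sum_subtractf algebra_simps)
  also have "\<dots> = (\<Sum>j<t. noise v (w j) (z j)) + (\<Sum>j<t. g (w j) (z j) \<bullet> (w j - v))"
    by (simp add: noise_def sum_subtractf sum.distrib)
  also have "(\<Sum>j<t. g (w j) (z j) \<bullet> (w j - v)) \<le> real t * e / 3"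
  proof -
    have "2 * \<eta> * (\<Sum>j<t. g (w j) (z j) \<bullet> (w j - v)) \<le> (dist c v)\<^sup>2 + real t * \<eta>\<^sup>2 * G\<^sup>2"
      unfolding w_def by (rule sgd_regret[OF c D v _ z]) (use \<eta> in auto)
    also have "\<dots> \<le> D\<^sup>2 + real t * \<eta>\<^sup>2 * G\<^sup>2" using v by (simp add: power_mono)
    also have "D\<^sup>2 \<le> real t * \<eta>\<^sup>2 * G\<^sup>2"
      using t(2) e G_pos by (simp add: \<eta>_def field_simps power2_eq_square)
    also have "real t * \<eta>\<^sup>2 * G\<^sup>2 + real t * \<eta>\<^sup>2 * G\<^sup>2 = 2 * \<eta> * (real t * e / 3)"
      using G_pos by (simp add: \<eta>_def field_simps power2_eq_square)
    finally show ?thesis using \<eta> by (simp only: mult_le_cancel_left_pos)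
  qed
  finally show ?thesis by (simp add: w_def)
qed

text \<open>A radius that dominates the error bound of the level set ensures that the ball around the centre
  contains a \<open>\<tau>\<close>-optimal point, so the localised stage loses nothing compared to that target.\<close>

lemma comparison_point:
  assumes c: "c \<in> \<K>" and pos: "0 < \<tau>" "0 \<le> e" "0 \<le> D"
    and B: "\<And>w. w \<in> level_set F \<K> \<tau> \<Longrightarrow> infdist w (opt_set F \<K>) \<le> B"
    and D: "B * e \<le> \<tau> * D" and gap: "F c \<le> opt_value F \<K> + \<tau> + e"
  obtains v where "v \<in> \<K> \<inter> cball c D" "F v \<le> opt_value F \<K> + \<tau>"
proof (cases "F c \<le> opt_value F \<K> + \<tau>")
  case True
  then show ?thesis using that[of c] c pos by simp
next
  case False
  then obtain v where v: "v \<in> level_set F \<K> \<tau>"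
    "\<tau> * dist c v \<le> infdist v (opt_set F \<K>) * (F c - opt_value F \<K> - \<tau>)"
    using level_point[OF c pos(1)] by (metis linear)
  note v(2)
  also have "\<dots> \<le> B * e"
    using B[OF v(1)] gap False infdist_nonneg[of v] order_trans[OF infdist_nonneg B[OF v(1)]]
    by (intro mult_mono) auto
  also note D
  finally have "dist c v \<le> D" using pos by simp
  then show ?thesis using that[of v] v(1) by (simp add: level_set_def)
qed

text \<open>A stage halves the excess \<open>e\<close> over the target accuracy \<open>\<tau>\<close> unless the average noise exceeds
  \<open>e / 6\<close>, which the Chernoff bound makes unlikely.\<close>

lemma stage_failure_prob:
  fixes c D t e
  defines "\<eta> \<equiv> e / (3 * G\<^sup>2)"
  assumes c: "c \<in> \<K>" and pos: "0 < \<tau>" "0 < e" "0 < D" "0 < t"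
    and B: "\<And>w. w \<in> level_set F \<K> \<tau> \<Longrightarrow> infdist w (opt_set F \<K>) \<le> B"
    and D: "B * e \<le> \<tau> * D" and gap: "F c \<le> opt_value F \<K> + \<tau> + e"
    and \<delta>: "0 < \<delta>" "\<delta> \<le> 1"
    and t: "max 9 (1728 * ln (1 / \<delta>)) * (G * D / e)\<^sup>2 \<le> real t"
  shows "emeasure (\<Pi>\<^sub>M j\<in>{..<t}. P) {z \<in> space (\<Pi>\<^sub>M j\<in>{..<t}. P).
      opt_value F \<K> + \<tau> + e / 2 < F (sgd_average \<K> g \<eta> c D z t)} \<le> ennreal \<delta>"
proof -
  let ?N = "\<Pi>\<^sub>M j\<in>{..<t}. P"
  obtain v where v: "v \<in> \<K> \<inter> cball c D" and Fv: "F v \<le> opt_value F \<K> + \<tau>"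
    using comparison_point[OF c _ _ _ B D gap] pos by auto
  let ?S = "\<lambda>z. \<Sum>j<t. noise v (sgd_iterate \<K> g \<eta> c D z j) (z j)"
  have S_meas[measurable]: "?S \<in> borel_measurable ?N"
    using cumulative_noise_measurable[OF c pos(3)] .
  define q where "q = (G * D / e)\<^sup>2"
  have q: "0 < q" using pos G_pos by (simp add: q_def)
  have t9: "9 * q \<le> real t" and tL: "1728 * ln (1 / \<delta>) * q \<le> real t"
    using t q mult_right_mono[of 9 "max 9 (1728 * ln (1 / \<delta>))" q]
      mult_right_mono[of "1728 * ln (1 / \<delta>)" "max 9 (1728 * ln (1 / \<delta>))" q]
    unfolding q_def[symmetric] by linarith+
  \<comment> \<open>this minimises the exponent \<open>2 * G\<^sup>2 * D\<^sup>2 * \<alpha>\<^sup>2 - \<alpha> * e / 6\<close>\<close>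
  define \<alpha> where "\<alpha> = 1 / (24 * q * e)"
  have \<alpha>: "0 < \<alpha>" using q pos by (simp add: \<alpha>_def)
  have "emeasure ?N {z \<in> space ?N. opt_value F \<K> + \<tau> + e / 2 < F (sgd_average \<K> g \<eta> c D z t)}
      \<le> emeasure ?N {z \<in> space ?N. real t * e / 6 \<le> ?S z}"
  proof (rule emeasure_mono)
    show "{z \<in> space ?N. opt_value F \<K> + \<tau> + e / 2 < F (sgd_average \<K> g \<eta> c D z t)}
        \<subseteq> {z \<in> space ?N. real t * e / 6 \<le> ?S z}"
    proof safe
      fix z assume z: "z \<in> space ?N"
        and bad: "opt_value F \<K> + \<tau> + e / 2 < F (sgd_average \<K> g \<eta> c D z t)"
      have "real t * (e / 2) \<le> real t * (F (sgd_average \<K> g \<eta> c D z t) - F v)"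
        using bad Fv by (intro mult_left_mono) auto
      also have "\<dots> \<le> ?S z + real t * e / 3"
        unfolding \<eta>_def using c pos v t9 z
        by (intro sgd_average_gap) (auto simp: q_def space_PiM)
      finally show "real t * e / 6 \<le> ?S z" by simp
    qed
  qed measurable
  also have "\<dots> \<le> ennreal (exp (- \<alpha> * (real t * e / 6))) *
      (\<integral>\<^sup>+z. ennreal (exp (\<alpha> * ?S z)) * indicator (space ?N) z \<partial>?N)"
    using \<alpha> by (intro Chernoff_ineq_nn_integral_ge) auto
  also have "(\<integral>\<^sup>+z. ennreal (exp (\<alpha> * ?S z)) * indicator (space ?N) z \<partial>?N)
      = (\<integral>\<^sup>+z. ennreal (exp (\<alpha> * ?S z)) \<partial>?N)"
    by (intro nn_integral_cong) auto
  also have "\<dots> \<le> ennreal (exp (real t * (2 * \<alpha>\<^sup>2 * G\<^sup>2 * D\<^sup>2)))"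
    by (rule cumulative_noise_mgf[OF c pos(3) v \<alpha>])
  also have "ennreal (exp (- \<alpha> * (real t * e / 6))) * ennreal (exp (real t * (2 * \<alpha>\<^sup>2 * G\<^sup>2 * D\<^sup>2)))
      = ennreal (exp (- (real t / (288 * q))))"
  proof -
    have "G\<^sup>2 * D\<^sup>2 = q * e\<^sup>2" using pos by (simp add: q_def field_simps power_mult_distrib)
    then have "2 * \<alpha>\<^sup>2 * G\<^sup>2 * D\<^sup>2 = 2 * \<alpha>\<^sup>2 * (q * e\<^sup>2)" by (simp add: mult.assoc)
    also have "\<dots> = 1 / (288 * q)"
      using q pos by (simp add: \<alpha>_def field_simps power2_eq_square)
    finally have a: "2 * \<alpha>\<^sup>2 * G\<^sup>2 * D\<^sup>2 = 1 / (288 * q)" .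
    have b: "- \<alpha> * (real t * e / 6) = - (real t / (144 * q))"
      using q pos by (simp add: \<alpha>_def field_simps)
    have "- (real t / (144 * q)) + real t * (1 / (288 * q)) = - (real t / (288 * q))"
      using q by (simp add: field_simps)
    then show ?thesis
      unfolding a b by (simp only: ennreal_mult[symmetric] exp_ge_zero exp_add[symmetric])
  qed
  also have "\<dots> \<le> ennreal \<delta>"
  proof (intro ennreal_leI)
    have "0 \<le> ln (1 / \<delta>)" using \<delta> by simp
    then have "ln (1 / \<delta>) * (288 * q) \<le> 1728 * ln (1 / \<delta>) * q" using q by simp
    then have "ln (1 / \<delta>) \<le> real t / (288 * q)"
      using tL q by (simp add: field_simps)
    then have "- (real t / (288 * q)) \<le> ln \<delta>" using \<delta> by (simp add: ln_div)
    then have "exp (- (real t / (288 * q))) \<le> exp (ln \<delta>)" by (simp only: exp_le_cancel_iff)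
    then show "exp (- (real t / (288 * q))) \<le> \<delta>" using \<delta> by simp
  qed
  finally show ?thesis by (simp add: mult_left_mono)
qed

end



text \<open>Independence survives measurable maps into different spaces, because the product law pushes
  forward. The past samples become a point of the Euclidean space, the fresh ones a block of samples.\<close>

lemma (in prob_space) indep_var_joint_distr_compose:
  assumes indep: "indep_var S X T Y" and f: "f \<in> S \<rightarrow>\<^sub>M S'" and h: "h \<in> T \<rightarrow>\<^sub>M T'"
  shows "distr M (S' \<Otimes>\<^sub>M T') (\<lambda>x. (f (X x), h (Y x)))
    = distr M S' (\<lambda>x. f (X x)) \<Otimes>\<^sub>M distr M T' (\<lambda>x. h (Y x))"
proof -
  have X[measurable]: "X \<in> M \<rightarrow>\<^sub>M S" and Y[measurable]: "Y \<in> M \<rightarrow>\<^sub>M T"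
    and joint: "distr M S X \<Otimes>\<^sub>M distr M T Y = distr M (S \<Otimes>\<^sub>M T) (\<lambda>x. (X x, Y x))"
    using indep unfolding indep_var_distribution_eq by auto
  note [measurable] = f h
  interpret Y': prob_space "distr M T' (\<lambda>x. h (Y x))" by (rule prob_space_distr) measurable
  have "distr M S' (\<lambda>x. f (X x)) \<Otimes>\<^sub>M distr M T' (\<lambda>x. h (Y x))
      = distr (distr M S X) S' f \<Otimes>\<^sub>M distr (distr M T Y) T' h"
    by (simp add: distr_distr comp_def)
  also have "\<dots> = distr (distr M S X \<Otimes>\<^sub>M distr M T Y) (S' \<Otimes>\<^sub>M T') (\<lambda>(x, y). (f x, h y))"
    by (intro pair_measure_distr)
      (simp_all add: distr_distr comp_def Y'.sigma_finite_measure_axioms)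
  also have "\<dots> = distr M (S' \<Otimes>\<^sub>M T') (\<lambda>x. (f (X x), h (Y x)))"
    unfolding joint by (simp add: distr_distr comp_def)
  finally show ?thesis by simp
qed

section \<open>The stages of all calls as one process\<close>

lemma assg_c_state_steps:
  "snd (assg_c_state \<K> g G z w0 t D1 \<epsilon>0 k) = (\<epsilon>0 / (3 * G\<^sup>2) / 2 ^ k, D1 / 2 ^ k)"
  by (induction k) (auto simp: Let_def split_beta)

lemma assg_c_state_point_Suc:
  "fst (assg_c_state \<K> g G z w0 t D1 \<epsilon>0 (Suc k)) =
    sgd_average \<K> g (\<epsilon>0 / (3 * G\<^sup>2) / 2 ^ k) (fst (assg_c_state \<K> g G z w0 t D1 \<epsilon>0 k)) (D1 / 2 ^ k) (z k) t"
  using assg_c_state_steps[of \<K> g G z w0 t D1 \<epsilon>0 k]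
  by (cases "assg_c_state \<K> g G z w0 t D1 \<epsilon>0 k") simp

lemma rassg_state_steps:
  "snd (rassg_state \<K> g G z 0 1 w0 K D1 t1 \<epsilon>0 s) =
    (t1 * 4 ^ s, D1 * 2 ^ s, \<epsilon>0, \<Sum>i<s. K * nat \<lceil>t1 * 4 ^ i\<rceil>)"
proof (induction s)
  case (Suc s)
  then show ?case
    by (cases "rassg_state \<K> g G z 0 1 w0 K D1 t1 \<epsilon>0 s") (simp add: mult_ac)
qed simp

context stochastic_subgradient
begin

text \<open>The point after \<open>k\<close> stages of the call with index \<open>s\<close>, counted from \<open>0\<close>, so that call \<open>s\<close> has stage
  length \<open>t1 * 4 ^ s\<close> and initial radius \<open>D1 * 2 ^ s\<close>. Running through the pairs \<open>(s, k)\<close>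
  lexicographically turns the nested loops into a single chain of stages.\<close>

definition stage_point ::
  "(nat \<Rightarrow> nat \<Rightarrow> nat \<Rightarrow> 'z) \<Rightarrow> 'a \<Rightarrow> nat \<Rightarrow> real \<Rightarrow> real \<Rightarrow> real \<Rightarrow> nat \<Rightarrow> nat \<Rightarrow> 'a" where
  "stage_point z w0 K D1 t1 \<epsilon>0 s k =
     fst (assg_c_state \<K> g G (z s) (fst (rassg_state \<K> g G z 0 1 w0 K D1 t1 \<epsilon>0 s))
       (nat \<lceil>t1 * 4 ^ s\<rceil>) (D1 * 2 ^ s) \<epsilon>0 k)"

lemma stage_point_0_0: "stage_point z w0 K D1 t1 \<epsilon>0 0 0 = w0"
  by (simp add: stage_point_def)

lemma rassg_state_point_Suc:
  "fst (rassg_state \<K> g G z 0 1 w0 K D1 t1 \<epsilon>0 (Suc s)) = stage_point z w0 K D1 t1 \<epsilon>0 s K"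
  using rassg_state_steps[of \<K> g G z w0 K D1 t1 \<epsilon>0 s]
  by (cases "rassg_state \<K> g G z 0 1 w0 K D1 t1 \<epsilon>0 s") (simp add: stage_point_def assg_c_def)

lemma stage_point_Suc_0:
  "stage_point z w0 K D1 t1 \<epsilon>0 (Suc s) 0 = stage_point z w0 K D1 t1 \<epsilon>0 s K"
  unfolding rassg_state_point_Suc[symmetric] by (simp add: stage_point_def)

lemma stage_point_Suc:
  "stage_point z w0 K D1 t1 \<epsilon>0 s (Suc k) =
    sgd_average \<K> g (\<epsilon>0 / 2 ^ k / (3 * G\<^sup>2)) (stage_point z w0 K D1 t1 \<epsilon>0 s k) (D1 * 2 ^ s / 2 ^ k)
      (z s k) (nat \<lceil>t1 * 4 ^ s\<rceil>)"
  unfolding stage_point_def assg_c_state_point_Suc by (simp add: mult_ac)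

lemma rassg_eq_stage_point:
  "rassg \<K> g G z 0 1 w0 K D1 t1 \<epsilon>0 (Suc s) = stage_point z w0 K D1 t1 \<epsilon>0 s K"
  unfolding rassg_def rassg_state_point_Suc[symmetric] by (simp only: split_beta)

lemma stage_induct [case_names start call stage]:
  assumes "Q 0 0" "\<And>s. Q s K \<Longrightarrow> Q (Suc s) (0::nat)" "\<And>s k. Q s k \<Longrightarrow> Q s (Suc k)"
  shows "Q s k"
proof (induction s arbitrary: k)
  case 0
  show ?case by (induction k) (use assms in auto)
next
  case (Suc s)
  show ?case by (induction k) (use assms Suc in auto)
qed

definition earlier_samples :: "nat \<Rightarrow> nat \<Rightarrow> (nat \<times> nat \<times> nat) set" where
  "earlier_samples s k = {(s', k', j). s' < s \<or> s' = s \<and> k' < k}"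

lemma stage_point_cong:
  assumes "\<And>s' k' j. (s', k', j) \<in> earlier_samples s k \<Longrightarrow> z s' k' j = z' s' k' j"
  shows "stage_point z w0 K D1 t1 \<epsilon>0 s k = stage_point z' w0 K D1 t1 \<epsilon>0 s k"
  using assms
proof (induction s k rule: stage_induct[where K = K])
  case (call s)
  have "stage_point z w0 K D1 t1 \<epsilon>0 s K = stage_point z' w0 K D1 t1 \<epsilon>0 s K"
    by (intro call.IH call.prems) (auto simp: earlier_samples_def)
  then show ?case by (simp add: stage_point_Suc_0)
next
  case (stage s k)
  have "stage_point z w0 K D1 t1 \<epsilon>0 s k = stage_point z' w0 K D1 t1 \<epsilon>0 s k"
    by (intro stage.IH stage.prems) (auto simp: earlier_samples_def)
  then show ?case
    using stage.prems unfolding stage_point_Suc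
    by (auto intro!: sgd_average_cong simp: earlier_samples_def)
qed (simp add: stage_point_0_0)

lemma stage_point_in:
  assumes "w0 \<in> \<K>" "0 < D1" "0 < t1"
  shows "stage_point z w0 K D1 t1 \<epsilon>0 s k \<in> \<K>"
proof (induction s k rule: stage_induct[where K = K])
  case (stage s k)
  then show ?case
    unfolding stage_point_Suc using assms by (intro sgd_average_in) auto
qed (use assms in \<open>simp_all add: stage_point_0_0 stage_point_Suc_0\<close>)

lemma stage_point_measurable:
  assumes "w0 \<in> \<K>" "0 < D1" "0 < t1"
    and "\<And>i. i \<in> earlier_samples s k \<Longrightarrow> \<zeta> i \<in> N \<rightarrow>\<^sub>M P"
  shows "(\<lambda>x. stage_point (\<lambda>s k j. \<zeta> (s, k, j) x) w0 K D1 t1 \<epsilon>0 s k) \<in> borel_measurable N"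
  using assms(4)
proof (induction s k rule: stage_induct[where K = K])
  case (call s)
  have "(\<lambda>x. stage_point (\<lambda>s k j. \<zeta> (s, k, j) x) w0 K D1 t1 \<epsilon>0 s K) \<in> borel_measurable N"
    by (intro call.IH call.prems) (auto simp: earlier_samples_def)
  then show ?case by (simp add: stage_point_Suc_0)
next
  case (stage s k)
  have "(\<lambda>x. stage_point (\<lambda>s k j. \<zeta> (s, k, j) x) w0 K D1 t1 \<epsilon>0 s k) \<in> borel_measurable N"
    by (intro stage.IH stage.prems) (auto simp: earlier_samples_def)
  then show ?case
    unfolding stage_point_Suc using assms(1-3) stage_point_in[OF assms(1-3)] stage.prems
    by (intro sgd_average_measurable) (auto simp: earlier_samples_def)
qed (simp add: stage_point_0_0)

section \<open>Failure probabilities\<close>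

text \<open>Condition on the centre: it is independent of the samples of the stage, so the bound for a fixed
  centre can be integrated over its distribution.\<close>

lemma random_centre_stage_failure_prob:
  fixes D t e
  defines "\<eta> \<equiv> e / (3 * G\<^sup>2)"
  assumes M: "prob_space M"
    and meas: "c \<in> borel_measurable M" "b \<in> M \<rightarrow>\<^sub>M (\<Pi>\<^sub>M j\<in>{..<t}. P)"
    and joint: "distr M (borel \<Otimes>\<^sub>M (\<Pi>\<^sub>M j\<in>{..<t}. P)) (\<lambda>x. (c x, b x))
      = distr M borel c \<Otimes>\<^sub>M (\<Pi>\<^sub>M j\<in>{..<t}. P)"
    and c: "\<And>x. x \<in> space M \<Longrightarrow> c x \<in> \<K>"
    and pos: "0 < \<tau>" "0 < e" "0 < D" "0 < t"
    and B: "\<And>w. w \<in> level_set F \<K> \<tau> \<Longrightarrow> infdist w (opt_set F \<K>) \<le> B"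
    and D: "B * e \<le> \<tau> * D"
    and \<delta>: "0 < \<delta>" "\<delta> \<le> 1"
    and t: "max 9 (1728 * ln (1 / \<delta>)) * (G * D / e)\<^sup>2 \<le> real t"
  shows "emeasure M {x \<in> space M. F (c x) \<le> opt_value F \<K> + \<tau> + e \<and>
      opt_value F \<K> + \<tau> + e / 2 < F (sgd_average \<K> g \<eta> (c x) D (b x) t)} \<le> ennreal \<delta>"
proof -
  interpret M: prob_space M by (rule M)
  let ?N = "\<Pi>\<^sub>M j\<in>{..<t}. P"
  interpret N: prob_space ?N using P_prob by (intro prob_space_PiM)
  \<comment> \<open>The objective and the iterates are controlled on \<open>\<K>\<close> only. Projecting the centre first makes all
    functions measurable on the whole space and changes nothing for centres in \<open>\<K>\<close>.\<close>
  let ?\<pi> = "closest_point \<K>"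
  have \<pi>_in: "?\<pi> y \<in> \<K>" for y
    using closest_point_in_set[OF K_closed, of y] optimum_exists by (auto simp: opt_set_eq)
  have \<pi>_meas: "(\<lambda>p. ?\<pi> (fst p)) \<in> borel_measurable (borel \<Otimes>\<^sub>M ?N)"
    using optimum_exists
    by (intro borel_measurable_compose_continuous_on[OF continuous_on_closest_point[OF K_convex K_closed]])
      (auto simp: opt_set_eq intro: UNIV_I)
  let ?bad = "\<lambda>y z. F (?\<pi> y) \<le> opt_value F \<K> + \<tau> + e \<and>
    opt_value F \<K> + \<tau> + e / 2 < F (sgd_average \<K> g \<eta> (?\<pi> y) D z t)"
  define E where "E = {p \<in> space (borel \<Otimes>\<^sub>M ?N). ?bad (fst p) (snd p)}"
  have [measurable]: "(\<lambda>p. F (?\<pi> (fst p))) \<in> borel_measurable (borel \<Otimes>\<^sub>M ?N)"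
    using \<pi>_meas \<pi>_in by (rule F_comp_measurable)
  have "(\<lambda>p. sgd_average \<K> g \<eta> (?\<pi> (fst p)) D (\<lambda>i. (\<lambda>i p. snd p i) i p) t)
      \<in> borel_measurable (borel \<Otimes>\<^sub>M ?N)"
    using pos \<pi>_in \<pi>_meas by (intro sgd_average_measurable) auto
  then have [measurable]:
    "(\<lambda>p. F (sgd_average \<K> g \<eta> (?\<pi> (fst p)) D (snd p) t)) \<in> borel_measurable (borel \<Otimes>\<^sub>M ?N)"
    using sgd_average_in[OF \<pi>_in] pos by (intro F_comp_measurable) auto
  have E[measurable]: "E \<in> sets (borel \<Otimes>\<^sub>M ?N)" unfolding E_def by measurable
  have slice: "emeasure ?N (Pair y -` E) \<le> ennreal \<delta>" for y
  proof (cases "F (?\<pi> y) \<le> opt_value F \<K> + \<tau> + e")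
    case True
    have "Pair y -` E = {z \<in> space ?N. opt_value F \<K> + \<tau> + e / 2 < F (sgd_average \<K> g \<eta> (?\<pi> y) D z t)}"
      using True by (auto simp: E_def space_pair_measure)
    then show ?thesis
      using stage_failure_prob[OF \<pi>_in pos B D True \<delta> t] by (simp add: \<eta>_def)
  next
    case False
    then have "Pair y -` E = {}" by (auto simp: E_def)
    then show ?thesis by simp
  qed
  have "{x \<in> space M. F (c x) \<le> opt_value F \<K> + \<tau> + e \<and>
      opt_value F \<K> + \<tau> + e / 2 < F (sgd_average \<K> g \<eta> (c x) D (b x) t)}
    = (\<lambda>x. (c x, b x)) -` E \<inter> space M"
    using c measurable_space[OF meas(2)]
    by (auto simp: E_def space_pair_measure closest_point_self)
  then have "emeasure M {x \<in> space M. F (c x) \<le> opt_value F \<K> + \<tau> + e \<and>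
      opt_value F \<K> + \<tau> + e / 2 < F (sgd_average \<K> g \<eta> (c x) D (b x) t)}
    = emeasure (distr M borel c \<Otimes>\<^sub>M ?N) E"
    unfolding joint[symmetric] using meas E by (simp add: emeasure_distr)
  also have "\<dots> = (\<integral>\<^sup>+y. emeasure ?N (Pair y -` E) \<partial>distr M borel c)"
    using E by (intro N.emeasure_pair_measure_alt) (simp cong: sets_pair_measure_cong)
  also have "\<dots> \<le> (\<integral>\<^sup>+y. ennreal \<delta> \<partial>distr M borel c)"
    by (intro nn_integral_mono slice)
  also have "\<dots> = ennreal \<delta>"
    using prob_space.emeasure_space_1[OF M.prob_space_distr[OF meas(1)]] by simp
  finally show ?thesis .
qed

lemma stage_point_indep_block:
  fixes s k t K :: nat and \<epsilon>0 :: real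
  assumes M: "prob_space M"
    and indep: "prob_space.indep_vars M (\<lambda>_. P) \<xi> UNIV"
    and law: "\<And>i. distr M P (\<xi> i) = P"
    and w0: "w0 \<in> \<K>" "0 < D1" "0 < t1" and t: "0 < t"
  defines "b \<equiv> \<lambda>x. \<lambda>j\<in>{..<t}. \<xi> (s, k, j) x"
  defines "W \<equiv> \<lambda>x. stage_point (\<lambda>s k j. \<xi> (s, k, j) x) w0 K D1 t1 \<epsilon>0 s k"
  shows "b \<in> M \<rightarrow>\<^sub>M (\<Pi>\<^sub>M j\<in>{..<t}. P)"
    and "distr M (borel \<Otimes>\<^sub>M (\<Pi>\<^sub>M j\<in>{..<t}. P)) (\<lambda>x. (W x, b x))
      = distr M borel W \<Otimes>\<^sub>M (\<Pi>\<^sub>M j\<in>{..<t}. P)"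
proof -
  interpret M: prob_space M by (rule M)
  let ?H = "earlier_samples s k" and ?J = "(\<lambda>j. (s, k, j)) ` {..<t}"
  have \<xi>_meas: "\<xi> i \<in> M \<rightarrow>\<^sub>M P" for i using indep unfolding M.indep_vars_def by blast
  then show "b \<in> M \<rightarrow>\<^sub>M (\<Pi>\<^sub>M j\<in>{..<t}. P)" unfolding b_def by (intro measurable_restrict)
  let ?past = "\<lambda>a. stage_point (\<lambda>s k j. a (s, k, j)) w0 K D1 t1 \<epsilon>0 s k"
  let ?block = "\<lambda>a. \<lambda>j\<in>{..<t}. a (s, k, j)"
  have past_eq: "?past (restrict (\<lambda>i. \<xi> i x) ?H) = W x" for x
    unfolding W_def by (intro stage_point_cong) auto
  have block_eq: "?block (restrict (\<lambda>i. \<xi> i x) ?J) = b x" for x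
    by (auto simp: fun_eq_iff b_def restrict_def)
  have past_meas: "?past \<in> borel_measurable (PiM ?H (\<lambda>_. P))"
    using stage_point_measurable[OF w0, of s k "\<lambda>i a. a i"] by simp
  have block_meas: "?block \<in> PiM ?J (\<lambda>_. P) \<rightarrow>\<^sub>M (\<Pi>\<^sub>M j\<in>{..<t}. P)"
    by (intro measurable_restrict measurable_component_singleton) auto
  have "M.indep_var (PiM ?H (\<lambda>_. P)) (\<lambda>x. restrict (\<lambda>i. \<xi> i x) ?H)
      (PiM ?J (\<lambda>_. P)) (\<lambda>x. restrict (\<lambda>i. \<xi> i x) ?J)"
    by (intro M.indep_var_restrict[OF indep]) (auto simp: earlier_samples_def)
  from M.indep_var_joint_distr_compose[OF this past_meas block_meas]
  have joint: "distr M (borel \<Otimes>\<^sub>M (\<Pi>\<^sub>M j\<in>{..<t}. P)) (\<lambda>x. (W x, b x))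
      = distr M borel W \<Otimes>\<^sub>M distr M (\<Pi>\<^sub>M j\<in>{..<t}. P) b"
    unfolding past_eq block_eq .
  have "M.indep_vars (\<lambda>_. P) (\<lambda>j x. (\<lambda>a. a (s, k, j)) (restrict (\<lambda>i. \<xi> i x) {(s, k, j)})) {..<t}"
    by (rule M.indep_vars_compose2[OF M.indep_vars_restrict[OF indep]])
      (auto simp: disjoint_family_on_def)
  then have "M.indep_vars (\<lambda>_. P) (\<lambda>j. \<xi> (s, k, j)) {..<t}" by simp
  then have "distr M (\<Pi>\<^sub>M j\<in>{..<t}. P) b = (\<Pi>\<^sub>M j\<in>{..<t}. P)"
    using t \<xi>_meas law unfolding b_def
    by (subst (asm) M.indep_vars_iff_distr_eq_PiM') auto
  then show "distr M (borel \<Otimes>\<^sub>M (\<Pi>\<^sub>M j\<in>{..<t}. P)) (\<lambda>x. (W x, b x))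
      = distr M borel W \<Otimes>\<^sub>M (\<Pi>\<^sub>M j\<in>{..<t}. P)"
    using joint by simp
qed

text \<open>The target of call \<open>s\<close> is \<open>max (\<epsilon>1 / 2 ^ s) \<epsilon>\<close>. Its radius doubles from call to call and hence satisfies
  the error bound for a target of half the size, with the same constant \<open>B\<close>. Stopping the targets
  at \<open>\<epsilon>\<close> keeps them in the range where \<open>B\<close> is a valid bound. Within a call each stage adds \<open>\<delta>\<close>
  to the failure probability. Between calls nothing is lost: a
  successful call ends within the initial tolerance \<open>\<epsilon>0\<close> that the next call starts from.\<close>

lemma stage_point_failure_prob:
  assumes M: "prob_space M"
    and indep: "prob_space.indep_vars M (\<lambda>_. P) \<xi> UNIV"
    and law: "\<And>i. distr M P (\<xi> i) = P"
    and w0: "w0 \<in> \<K>" "F w0 \<le> opt_value F \<K> + \<epsilon>0"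
    and eps: "0 < \<epsilon>" "\<epsilon> \<le> \<epsilon>1" "\<epsilon>1 \<le> \<epsilon>0 / 2" and K: "1 \<le> K"
    and B: "0 < B" "\<And>e w. \<epsilon> \<le> e \<Longrightarrow> e \<le> \<epsilon>1 \<Longrightarrow> w \<in> level_set F \<K> e \<Longrightarrow> infdist w (opt_set F \<K>) \<le> B"
    and \<delta>: "0 < \<delta>" "\<delta> \<le> 1"
    and D1: "D1 = B * \<epsilon>0 / \<epsilon>1"
    and t1: "t1 = max 9 (1728 * ln (1 / \<delta>)) * (G * D1 / \<epsilon>0)\<^sup>2"
  shows "measure M {x \<in> space M. opt_value F \<K> + max (\<epsilon>1 / 2 ^ s) \<epsilon> + \<epsilon>0 / 2 ^ k <
      F (stage_point (\<lambda>s k j. \<xi> (s, k, j) x) w0 K D1 t1 \<epsilon>0 s k)} \<le> real (s * K + k) * \<delta>"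
proof -
  interpret M: prob_space M by (rule M)
  have \<epsilon>0: "0 < \<epsilon>0" and \<epsilon>1: "0 < \<epsilon>1" using eps by linarith+
  have D1_pos: "0 < D1" using \<epsilon>0 \<epsilon>1 B by (simp add: D1)
  have t1_pos: "0 < t1" using D1_pos \<epsilon>0 G_pos by (simp add: t1)
  define \<tau> where "\<tau> = (\<lambda>s::nat. max (\<epsilon>1 / 2 ^ s) \<epsilon>)"
  define W where "W = (\<lambda>s k x. stage_point (\<lambda>s k j. \<xi> (s, k, j) x) w0 K D1 t1 \<epsilon>0 s k)"
  define bad where "bad = (\<lambda>s k. {x \<in> space M. opt_value F \<K> + \<tau> s + \<epsilon>0 / 2 ^ k < F (W s k x)})"
  have \<tau>_pos: "0 < \<tau> s" for s using eps by (simp add: \<tau>_def)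
  have "\<epsilon>1 / 2 ^ s \<le> \<epsilon>1" for s
    using \<epsilon>1 divide_left_mono[of 1 "2 ^ s" \<epsilon>1] by simp
  then have \<tau>_range: "\<epsilon> \<le> \<tau> s" "\<tau> s \<le> \<epsilon>1" for s using eps by (auto simp: \<tau>_def)
  have \<tau>_lower: "\<epsilon>1 \<le> \<tau> s * 2 ^ s" for s
  proof -
    have "\<epsilon>1 / 2 ^ s \<le> \<tau> s" by (simp add: \<tau>_def)
    then show ?thesis by (simp add: field_simps)
  qed
  have W_in: "W s k x \<in> \<K>" for s k x
    unfolding W_def by (rule stage_point_in[OF w0(1) D1_pos t1_pos])
  have W_meas: "W s k \<in> borel_measurable M" for s k
    unfolding W_def using indep
    by (intro stage_point_measurable[OF w0(1) D1_pos t1_pos]) (auto simp: M.indep_vars_def)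
  have [measurable]: "(\<lambda>x. F (W s k x)) \<in> borel_measurable M" for s k
    using W_meas W_in by (intro F_comp_measurable)
  have bad_sets[measurable]: "bad s k \<in> sets M" for s k
    unfolding bad_def by measurable
  have "measure M (bad s k) \<le> real (s * K + k) * \<delta>"
  proof (induction s k rule: stage_induct[where K = K])
    case start
    have "bad 0 0 = {}"
      using w0 \<tau>_pos[of 0] by (auto simp: bad_def W_def stage_point_0_0)
    then show ?case by simp
  next
    case (call s)
    have "(2::real) ^ 1 \<le> 2 ^ K" using K by (intro power_increasing) auto
    then have "\<epsilon>0 / 2 ^ K \<le> \<epsilon>0 / 2" using \<epsilon>0 by (intro divide_left_mono) auto
    then have "\<tau> s + \<epsilon>0 / 2 ^ K \<le> \<tau> (Suc s) + \<epsilon>0"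
      using \<tau>_range(2)[of s] \<tau>_pos[of "Suc s"] eps(3) by linarith
    then have "bad (Suc s) 0 \<subseteq> bad s K"
      by (auto simp: bad_def W_def stage_point_Suc_0)
    then have "measure M (bad (Suc s) 0) \<le> measure M (bad s K)"
      by (intro M.finite_measure_mono) auto
    then show ?case using call by (simp add: add.commute)
  next
    case (stage s k)
    define t where "t = nat \<lceil>t1 * 4 ^ s\<rceil>"
    define e where "e = \<epsilon>0 / 2 ^ k"
    define D where "D = D1 * 2 ^ s / 2 ^ k"
    define b where "b = (\<lambda>x. \<lambda>j\<in>{..<t}. \<xi> (s, k, j) x)"
    have pos: "0 < e" "0 < D" "0 < t"
      using \<epsilon>0 D1_pos t1_pos by (auto simp: e_def D_def t_def)
    note block = stage_point_indep_block[OF M indep law w0(1) D1_pos t1_pos pos(3)]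
    have b_meas: "b \<in> M \<rightarrow>\<^sub>M (\<Pi>\<^sub>M j\<in>{..<t}. P)" unfolding b_def by (rule block(1))
    have joint: "distr M (borel \<Otimes>\<^sub>M (\<Pi>\<^sub>M j\<in>{..<t}. P)) (\<lambda>x. (W s k x, b x))
        = distr M borel (W s k) \<Otimes>\<^sub>M (\<Pi>\<^sub>M j\<in>{..<t}. P)"
      unfolding W_def b_def by (rule block(2))
    have "B * e \<le> \<tau> s * D"
      using mult_left_mono[OF \<tau>_lower[of s], of "B * e / \<epsilon>1"] B \<epsilon>1 pos
      by (simp add: D_def D1 e_def field_simps)
    moreover have "max 9 (1728 * ln (1 / \<delta>)) * (G * D / e)\<^sup>2 \<le> real t"
    proof -
      have "G * D / e = (G * D1 / \<epsilon>0) * 2 ^ s" by (simp add: D_def e_def)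
      then have "max 9 (1728 * ln (1 / \<delta>)) * (G * D / e)\<^sup>2 = t1 * (2 ^ s)\<^sup>2"
        by (simp add: t1 power_mult_distrib power_divide)
      also have "((2::real) ^ s)\<^sup>2 = 4 ^ s" by (simp add: power2_eq_square flip: power_mult_distrib)
      finally show ?thesis unfolding t_def by (simp only: of_nat_ceiling)
    qed
    ultimately have "emeasure M {x \<in> space M. F (W s k x) \<le> opt_value F \<K> + \<tau> s + e \<and>
        opt_value F \<K> + \<tau> s + e / 2 < F (sgd_average \<K> g (e / (3 * G\<^sup>2)) (W s k x) D (b x) t)} \<le> ennreal \<delta>"
      using B(2) \<tau>_range \<delta> pos \<tau>_pos W_in W_meas b_meas joint
      by (intro random_centre_stage_failure_prob[OF M]) auto
    moreover have "sgd_average \<K> g (e / (3 * G\<^sup>2)) (W s k x) D (b x) t = W s (Suc k) x" for x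
      unfolding W_def stage_point_Suc e_def D_def t_def[symmetric]
      by (intro sgd_average_cong) (simp add: b_def)
    ultimately have fresh: "measure M {x \<in> space M. F (W s k x) \<le> opt_value F \<K> + \<tau> s + e \<and>
        opt_value F \<K> + \<tau> s + e / 2 < F (W s (Suc k) x)} \<le> \<delta>"
      using \<delta> by (simp add: M.emeasure_eq_measure)
    have "bad s (Suc k) \<subseteq> bad s k \<union> {x \<in> space M. F (W s k x) \<le> opt_value F \<K> + \<tau> s + e \<and>
        opt_value F \<K> + \<tau> s + e / 2 < F (W s (Suc k) x)}"
      by (auto simp: bad_def e_def)
    then have "measure M (bad s (Suc k)) \<le> measure M (bad s k \<union> {x \<in> space M.
        F (W s k x) \<le> opt_value F \<K> + \<tau> s + e \<and> opt_value F \<K> + \<tau> s + e / 2 < F (W s (Suc k) x)})"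
      by (intro M.finite_measure_mono) measurable
    also have "\<dots> \<le> measure M (bad s k) + \<delta>"
      by (intro order_trans[OF measure_Un_le] add_left_mono fresh) measurable
    finally show ?case using stage by (simp add: algebra_simps)
  qed
  then show ?thesis by (simp add: bad_def W_def \<tau>_def)
qed

end



section \<open>Iteration count and conclusion\<close>

lemma rassg_iterations_eq:
  "rassg_iterations \<K> g G z 0 1 w0 K D1 t1 \<epsilon>0 S = (\<Sum>i<S. K * nat \<lceil>t1 * 4 ^ i\<rceil>)"
  unfolding rassg_iterations_def
  using rassg_state_steps[of \<K> g G z w0 K D1 t1 \<epsilon>0 S]
  by (cases "rassg_state \<K> g G z 0 1 w0 K D1 t1 \<epsilon>0 S") simp

lemma geometric_ceiling_sum_le:
  fixes t1 :: real
  assumes t1: "9 \<le> t1"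
  shows "real (\<Sum>i<S. K * nat \<lceil>t1 * 4 ^ i\<rceil>) \<le> real K * (10 / 27 * t1 * 4 ^ S)"
proof -
  have "real (nat \<lceil>t1 * 4 ^ i\<rceil>) \<le> 10 / 9 * t1 * 4 ^ i" for i
  proof -
    have "9 * 1 \<le> t1 * 4 ^ i" using t1 by (intro mult_mono) auto
    then show ?thesis using of_nat_ceiling[of "t1 * 4 ^ i"] by linarith
  qed
  then have "(\<Sum>i<S. real (nat \<lceil>t1 * 4 ^ i\<rceil>)) \<le> (\<Sum>i<S. 10 / 9 * t1 * 4 ^ i)"
    by (intro sum_mono)
  also have "\<dots> = 10 / 9 * t1 * (\<Sum>i<S. 4 ^ i)" by (simp only: sum_distrib_left)
  also have "(\<Sum>i<S. 4 ^ i) = ((4::real) ^ S - 1) / 3" by (simp add: sum_gp_strict field_simps)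
  also have "10 / 9 * t1 * (((4::real) ^ S - 1) / 3) = 10 / 27 * t1 * 4 ^ S - 10 / 27 * t1"
    by (simp add: field_simps)
  also have "\<dots> \<le> 10 / 27 * t1 * 4 ^ S" using t1 by linarith
  finally have "real K * (\<Sum>i<S. real (nat \<lceil>t1 * 4 ^ i\<rceil>)) \<le> real K * (10 / 27 * t1 * 4 ^ S)"
    by (intro mult_left_mono) auto
  then show ?thesis by (simp add: sum_distrib_left)
qed

lemma ln_inverse_delta'_bounds:
  assumes K: "2 \<le> K" and \<delta>: "0 < \<delta>" "\<delta> < (1::real)"
  defines "\<delta>' \<equiv> \<delta> / (real K * (real K + 1))"
  shows "0 < \<delta>'" "\<delta>' \<le> 1" "1 / 2 \<le> ln (1 / \<delta>')" "ln (1 / \<delta>') \<le> ln (1 / \<delta>) + 3 * ln (real K)"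
proof -
  have KK: "2 * 1 \<le> real K * (real K + 1)" using K by (intro mult_mono) auto
  show pos: "0 < \<delta>'" using \<delta> K by (simp add: \<delta>'_def)
  have half: "\<delta>' \<le> 1 / 2"
  proof -
    have "\<delta>' \<le> 1 / (real K * (real K + 1))" unfolding \<delta>'_def using \<delta> KK by (intro divide_right_mono) auto
    also have "\<dots> \<le> 1 / 2" using KK by (intro divide_left_mono) auto
    finally show ?thesis .
  qed
  then show "\<delta>' \<le> 1" by simp
  have "ln 2 \<le> ln (1 / \<delta>')" using half pos by (subst ln_le_cancel_iff) (auto simp: field_simps)
  then show "1 / 2 \<le> ln (1 / \<delta>')" using ln2_ge_two_thirds by linarith
  have "real K + 1 \<le> (real K)\<^sup>2"
  proof -
    have "2 * real K \<le> real K * real K" using K by (intro mult_right_mono) auto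
    then show ?thesis using K unfolding power2_eq_square by linarith
  qed
  then have "ln (real K + 1) \<le> ln ((real K)\<^sup>2)" using K by (subst ln_le_cancel_iff) auto
  also have "\<dots> = 2 * ln (real K)" using K by (simp add: ln_realpow)
  finally have "ln (real K + 1) \<le> 2 * ln (real K)" .
  moreover have "ln (1 / \<delta>') = ln (1 / \<delta>) + (ln (real K) + ln (real K + 1))"
  proof -
    have "1 / \<delta>' = 1 / \<delta> * (real K * (real K + 1))" by (simp add: \<delta>'_def)
    also have "ln \<dots> = ln (1 / \<delta>) + ln (real K * (real K + 1))"
      using \<delta> K by (intro ln_mult_pos) auto
    also have "ln (real K * (real K + 1)) = ln (real K) + ln (real K + 1)"
      using K by (intro ln_mult_pos) auto
    finally show ?thesis .
  qed
  ultimately show "ln (1 / \<delta>') \<le> ln (1 / \<delta>) + 3 * ln (real K)" by simp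
qed

lemma call_count_bounds:
  fixes \<epsilon> \<epsilon>1 :: real
  assumes "0 < \<epsilon>" "\<epsilon> \<le> \<epsilon>1"
  defines "m \<equiv> nat \<lceil>log 2 (\<epsilon>1 / \<epsilon>)\<rceil>"
  shows "\<epsilon>1 / 2 ^ m \<le> \<epsilon>" "4 ^ Suc m \<le> 16 * (\<epsilon>1 / \<epsilon>)\<^sup>2"
proof -
  have pos: "0 < \<epsilon>1 / \<epsilon>" and ge1: "1 \<le> \<epsilon>1 / \<epsilon>" using assms by auto
  then have log0: "0 \<le> log 2 (\<epsilon>1 / \<epsilon>)" by (subst zero_le_log_cancel_iff) auto
  have m: "log 2 (\<epsilon>1 / \<epsilon>) \<le> real m" "real m \<le> log 2 (\<epsilon>1 / \<epsilon>) + 1"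
    unfolding m_def using log0 by linarith+
  have log_pow: "2 powr log 2 (\<epsilon>1 / \<epsilon>) = \<epsilon>1 / \<epsilon>" using pos by simp
  have "\<epsilon>1 / \<epsilon> \<le> 2 powr real m"
    using powr_mono[OF m(1), of 2] log_pow by simp
  then show "\<epsilon>1 / 2 ^ m \<le> \<epsilon>" using assms(1,2) by (simp add: powr_realpow field_simps)
  have "2 powr real m \<le> 2 powr (log 2 (\<epsilon>1 / \<epsilon>) + 1)"
    using m(2) by (intro powr_mono) auto
  also have "\<dots> = \<epsilon>1 / \<epsilon> * 2" using log_pow by (simp add: powr_add)
  finally have "(2::real) ^ m \<le> \<epsilon>1 / \<epsilon> * 2" by (simp add: powr_realpow)
  then have "((2::real) ^ m)\<^sup>2 \<le> (\<epsilon>1 / \<epsilon> * 2)\<^sup>2" by (intro power_mono) auto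
  moreover have "((2::real) ^ m)\<^sup>2 = 4 ^ m" by (simp add: power2_eq_square flip: power_mult_distrib)
  ultimately show "4 ^ Suc m \<le> 16 * (\<epsilon>1 / \<epsilon>)\<^sup>2" by (simp add: power_mult_distrib power_divide)
qed

lemma call_count_le_stage_count:
  fixes \<epsilon>0 \<epsilon>1 \<epsilon> :: real
  assumes "0 < \<epsilon>" "\<epsilon> \<le> \<epsilon>1" "\<epsilon>1 \<le> \<epsilon>0 / 2"
  shows "nat \<lceil>log 2 (\<epsilon>1 / \<epsilon>)\<rceil> + 1 \<le> nat \<lceil>log 2 (\<epsilon>0 / \<epsilon>)\<rceil>"
proof -
  have "log 2 (\<epsilon>1 / \<epsilon>) \<le> log 2 (\<epsilon>0 / \<epsilon> / 2)"
    using assms by (subst log_le_cancel_iff) (auto simp: field_simps)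
  also have "\<dots> = log 2 (\<epsilon>0 / \<epsilon>) - 1" using assms by (subst log_divide) auto
  finally have "\<lceil>log 2 (\<epsilon>1 / \<epsilon>)\<rceil> + 1 \<le> \<lceil>log 2 (\<epsilon>0 / \<epsilon>)\<rceil>" by linarith
  moreover have "0 \<le> log 2 (\<epsilon>1 / \<epsilon>)" using assms by (subst zero_le_log_cancel_iff) auto
  ultimately show ?thesis by linarith
qed

text \<open>The stage lengths grow geometrically, so the last call dominates, and its length is of order
  \<open>4 ^ S * ln (1 / \<delta>') * (G * B / \<epsilon>1)\<^sup>2\<close> with \<open>4 ^ S\<close> of order \<open>(\<epsilon>1 / \<epsilon>)\<^sup>2\<close>; the unknown \<open>\<epsilon>1\<close> cancels.\<close>

lemma iteration_bound:
  fixes B G \<epsilon> \<epsilon>0 \<epsilon>1 \<delta> D1 :: real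
  assumes G: "0 < G" and eps: "0 < \<epsilon>" "\<epsilon> \<le> \<epsilon>1" "0 < \<epsilon>0" and B: "\<epsilon>1 / G \<le> B"
    and K: "2 \<le> K" and \<delta>: "0 < \<delta>" "\<delta> < 1" and D1: "D1 = B * \<epsilon>0 / \<epsilon>1"
    and \<delta>': "\<delta>' = \<delta> / (real K * (real K + 1))"
    and t1: "t1 = max 9 (1728 * ln (1 / \<delta>')) * (G * D1 / \<epsilon>0)\<^sup>2"
    and S: "S = nat \<lceil>log 2 (\<epsilon>1 / \<epsilon>)\<rceil> + 1"
  shows "real (\<Sum>i<S. K * nat \<lceil>t1 * 4 ^ i\<rceil>)
    \<le> 10240 * (real K * (ln (1 / \<delta>) + 3 * ln (real K)) * (G\<^sup>2 * B\<^sup>2 / \<epsilon>\<^sup>2))"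
proof -
  note L = ln_inverse_delta'_bounds[OF K \<delta>, folded \<delta>']
  have \<epsilon>1: "0 < \<epsilon>1" using eps by simp
  have max_eq: "max 9 (1728 * ln (1 / \<delta>')) = 1728 * ln (1 / \<delta>')" using L by linarith
  have q: "G * D1 / \<epsilon>0 = G * B / \<epsilon>1" using eps \<epsilon>1 by (simp add: D1)
  have q1: "1 \<le> G * B / \<epsilon>1" using B G \<epsilon>1 by (simp add: field_simps)
  have "9 * 1 \<le> t1"
    unfolding t1 q using q1 by (intro mult_mono one_le_power) auto
  then have "real (\<Sum>i<S. K * nat \<lceil>t1 * 4 ^ i\<rceil>) \<le> real K * (10 / 27 * t1 * 4 ^ S)"
    by (intro geometric_ceiling_sum_le) simp
  also have "\<dots> \<le> real K * (10 / 27 * t1 * (16 * (\<epsilon>1 / \<epsilon>)\<^sup>2))"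
    using call_count_bounds(2)[OF eps(1,2)] \<open>9 * 1 \<le> t1\<close>
    by (intro mult_left_mono) (simp_all add: S)
  also have "\<dots> = 10240 * (real K * ln (1 / \<delta>') * (G\<^sup>2 * B\<^sup>2 / \<epsilon>\<^sup>2))"
    unfolding t1 max_eq q using eps \<epsilon>1 by (simp add: field_simps)
  also have "\<dots> \<le> 10240 * (real K * (ln (1 / \<delta>) + 3 * ln (real K)) * (G\<^sup>2 * B\<^sup>2 / \<epsilon>\<^sup>2))"
    using L(4) by (intro mult_left_mono mult_right_mono) auto
  finally show ?thesis .
qed

theorem theorem12:
  fixes \<K> :: "'a::euclidean_space set"
    and P :: "'z measure"
    and f :: "'a \<Rightarrow> 'z \<Rightarrow> real"
    and g :: "'a \<Rightarrow> 'z \<Rightarrow> 'a"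
    and F :: "'a \<Rightarrow> real"
    and M :: "'p measure"
    and \<xi> :: "nat \<times> nat \<times> nat \<Rightarrow> 'p \<Rightarrow> 'z"
    and w0 :: 'a
    and G \<epsilon>0 \<epsilon> \<epsilon>1 \<delta> \<delta>' D1 t1 :: real
    and K S :: nat
  assumes K_closed: "closed \<K>" and K_convex: "convex \<K>"
    and P_prob: "prob_space P"
    and f_convex: "\<And>z. z \<in> space P \<Longrightarrow> convex_on UNIV (\<lambda>w. f w z)"
    and f_integrable: "\<And>w. w \<in> \<K> \<Longrightarrow> integrable P (f w)"
    and F_eq: "F = objective P f"
    and optimum_exists: "opt_set F \<K> \<noteq> {}"
    and subgradient: "\<And>w z. w \<in> \<K> \<Longrightarrow> z \<in> space P \<Longrightarrow> g w z \<in> subdifferential (\<lambda>u. f u z) w"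
    and g_measurable: "(\<lambda>(w, z). g w z) \<in> borel_measurable (borel \<Otimes>\<^sub>M P)"
    and G_pos: "0 < G"
    and g_bound: "\<And>w z. w \<in> \<K> \<Longrightarrow> z \<in> space P \<Longrightarrow> norm (g w z) \<le> G"
    and M_prob: "prob_space M"
    and samples_indep: "prob_space.indep_vars M (\<lambda>_. P) \<xi> UNIV"
    and samples_law: "\<And>i. distr M P (\<xi> i) = P"
    and w0_in: "w0 \<in> \<K>"
    and w0_gap: "F w0 - opt_value F \<K> \<le> \<epsilon>0"
    and eps_pos: "0 < \<epsilon>" and eps_le: "\<epsilon> \<le> \<epsilon>0 / 4"
    and delta_range: "0 < \<delta>" "\<delta> < 1"
    and K_eq: "K = nat \<lceil>log 2 (\<epsilon>0 / \<epsilon>)\<rceil>"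
    and eps1_range: "\<epsilon> \<le> \<epsilon>1" "\<epsilon>1 \<le> \<epsilon>0 / 2"
    and level_nonempty: "level_set F \<K> \<epsilon>1 \<noteq> {}"
    and level_bounded: "bdd_above ((\<lambda>w. infdist w (opt_set F \<K>)) ` level_set F \<K> \<epsilon>1)"
    and level_monotone: "\<And>e w. \<epsilon> \<le> e \<Longrightarrow> e < \<epsilon>1 \<Longrightarrow> w \<in> level_set F \<K> e \<Longrightarrow>
        infdist w (opt_set F \<K>) \<le> level_dist F \<K> \<epsilon>1"
    and D1_eq: "D1 = level_dist F \<K> \<epsilon>1 * \<epsilon>0 / \<epsilon>1"
    and delta'_eq: "\<delta>' = \<delta> / (real K * (real K + 1))"
    and t1_eq: "t1 = max 9 (1728 * ln (1 / \<delta>')) * (G * D1 / \<epsilon>0)\<^sup>2"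
    and S_eq: "S = nat \<lceil>log 2 (\<epsilon>1 / \<epsilon>)\<rceil> + 1"
  shows
    "measure M {x \<in> space M.
        F (rassg \<K> g G (\<lambda>s k j. \<xi> (s, k, j) x) 0 1 w0 K D1 t1 \<epsilon>0 S) - opt_value F \<K> \<le> 2 * \<epsilon>}
      \<ge> 1 - \<delta> \<and>
     (\<forall>z. real (rassg_iterations \<K> g G z 0 1 w0 K D1 t1 \<epsilon>0 S)
      \<le> 10 ^ 5 * (real K * (ln (1 / \<delta>) + ln (real K)) * (G\<^sup>2 * (level_dist F \<K> \<epsilon>1)\<^sup>2 / \<epsilon>\<^sup>2))) \<and>
     (\<delta> \<le> 1 / 2 \<longrightarrow> (\<forall>z. real (rassg_iterations \<K> g G z 0 1 w0 K D1 t1 \<epsilon>0 S)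
      \<le> 10 ^ 5 * (1 + ln (real K)) *
          (real K * ln (1 / \<delta>) * (G\<^sup>2 * (level_dist F \<K> \<epsilon>1)\<^sup>2 / \<epsilon>\<^sup>2))))"
proof -
  interpret stochastic_subgradient \<K> P f g F G
    by (rule stochastic_subgradient.intro) (fact assms)+
  define B where "B = level_dist F \<K> \<epsilon>1"
  have \<epsilon>1: "0 < \<epsilon>1" and \<epsilon>0: "0 < \<epsilon>0" using eps_pos eps_le eps1_range by linarith+
  have B_ge: "\<epsilon>1 / G \<le> B"
    unfolding B_def using \<epsilon>1 level_nonempty level_bounded by (intro level_dist_ge) auto
  then have B: "0 < B" using \<epsilon>1 G_pos by (smt (verit) divide_pos_pos)
  have level: "infdist w (opt_set F \<K>) \<le> B" if "\<epsilon> \<le> e" "e \<le> \<epsilon>1" "w \<in> level_set F \<K> e" for e w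
  proof (cases "e < \<epsilon>1")
    case True
    then show ?thesis using level_monotone that by (simp add: B_def)
  next
    case False
    then show ?thesis
      using that level_bounded unfolding B_def level_dist_def by (auto intro!: cSUP_upper)
  qed
  \<comment> \<open>at most \<open>S * K\<close> stages are run, and each may fail with probability \<open>\<delta> / (K * (K + 1))\<close>\<close>
  have SK: "S \<le> K" unfolding S_eq K_eq using eps_pos eps1_range by (rule call_count_le_stage_count)
  have K2: "2 \<le> K"
  proof -
    have "2 \<le> log 2 (\<epsilon>0 / \<epsilon>)"
      using eps_pos eps_le by (subst le_log_iff) (auto simp: field_simps)
    then show ?thesis unfolding K_eq by linarith
  qed
  have last_stage: "\<epsilon>0 / 2 ^ K \<le> \<epsilon>"
    unfolding K_eq using eps_pos eps_le by (intro call_count_bounds(1)) auto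
  note \<delta>' = ln_inverse_delta'_bounds[OF K2 delta_range, folded delta'_eq]
  obtain m where m: "S = Suc m" "m = nat \<lceil>log 2 (\<epsilon>1 / \<epsilon>)\<rceil>" using S_eq by simp
  have target: "max (\<epsilon>1 / 2 ^ m) \<epsilon> = \<epsilon>"
    unfolding m(2) using call_count_bounds(1)[OF eps_pos eps1_range(1)] by simp
  let ?gap = "\<lambda>x. F (rassg \<K> g G (\<lambda>s k j. \<xi> (s, k, j) x) 0 1 w0 K D1 t1 \<epsilon>0 S) - opt_value F \<K>"
  interpret M: prob_space M by (rule M_prob)
  have D1_pos: "0 < D1" using B \<epsilon>0 \<epsilon>1 by (simp add: D1_eq B_def)
  have t1_pos: "0 < t1" using D1_pos \<epsilon>0 G_pos by (simp add: t1_eq)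
  let ?W = "\<lambda>x. stage_point (\<lambda>s k j. \<xi> (s, k, j) x) w0 K D1 t1 \<epsilon>0 m K"
  have "measure M {x \<in> space M. opt_value F \<K> + max (\<epsilon>1 / 2 ^ m) \<epsilon> + \<epsilon>0 / 2 ^ K < F (?W x)}
      \<le> real (m * K + K) * \<delta>'"
    using w0_gap K2
    by (intro stage_point_failure_prob[OF M_prob samples_indep samples_law w0_in _ eps_pos eps1_range
          _ B level \<delta>'(1,2) D1_eq[folded B_def] t1_eq]) auto
  also have "real (m * K + K) * \<delta>' = real S * real K * \<delta> / (real K * (real K + 1))"
    by (simp add: m(1) delta'_eq algebra_simps)
  also have "\<dots> \<le> \<delta>"
  proof -
    have "\<delta> * real S \<le> \<delta> * (real K + 1)"
      using SK delta_range by (intro mult_left_mono) auto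
    then show ?thesis using K2 by (simp add: divide_le_eq mult_ac)
  qed
  finally have fail: "measure M {x \<in> space M. opt_value F \<K> + \<epsilon> + \<epsilon>0 / 2 ^ K < F (?W x)} \<le> \<delta>"
    unfolding target .
  have W_meas: "?W \<in> borel_measurable M"
    using samples_indep
    by (intro stage_point_measurable[OF w0_in D1_pos t1_pos]) (auto simp: M.indep_vars_def)
  have [measurable]: "(\<lambda>x. F (?W x)) \<in> borel_measurable M"
    using W_meas stage_point_in[OF w0_in D1_pos t1_pos] by (rule F_comp_measurable)
  let ?good = "{x \<in> space M. F (?W x) \<le> opt_value F \<K> + \<epsilon> + \<epsilon>0 / 2 ^ K}"
  have "measure M ?good = 1 - measure M (space M - ?good)"
    by (subst M.prob_compl) auto
  also have "space M - ?good = {x \<in> space M. opt_value F \<K> + \<epsilon> + \<epsilon>0 / 2 ^ K < F (?W x)}" by auto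
  finally have "1 - \<delta> \<le> measure M ?good" using fail by simp
  also have "\<dots> \<le> measure M {x \<in> space M. ?gap x \<le> 2 * \<epsilon>}"
    unfolding m(1) rassg_eq_stage_point using last_stage
    by (intro M.finite_measure_mono) auto
  finally have success: "1 - \<delta> \<le> measure M {x \<in> space M. ?gap x \<le> 2 * \<epsilon>}" .

  let ?Q = "G\<^sup>2 * B\<^sup>2 / \<epsilon>\<^sup>2"
  have lnK: "0 \<le> ln (real K)" and ln\<delta>: "0 \<le> ln (1 / \<delta>)" using K2 delta_range by auto
  have iter: "real (rassg_iterations \<K> g G z 0 1 w0 K D1 t1 \<epsilon>0 S)
      \<le> 10240 * (real K * (ln (1 / \<delta>) + 3 * ln (real K)) * ?Q)" for z
    unfolding rassg_iterations_eq
    by (rule iteration_bound[OF G_pos eps_pos eps1_range(1) \<epsilon>0 B_ge K2 delta_range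
          D1_eq[folded B_def] delta'_eq t1_eq S_eq])
  have "10240 * (real K * (ln (1 / \<delta>) + 3 * ln (real K)) * ?Q)
      \<le> 10240 * (real K * (3 * (ln (1 / \<delta>) + ln (real K))) * ?Q)"
    using ln\<delta> by (intro mult_left_mono mult_right_mono) auto
  also have "\<dots> = 30720 * (real K * (ln (1 / \<delta>) + ln (real K)) * ?Q)" by simp
  also have "\<dots> \<le> 10 ^ 5 * (real K * (ln (1 / \<delta>) + ln (real K)) * ?Q)"
    using lnK ln\<delta> by (intro mult_right_mono) auto
  finally have bound1: "10240 * (real K * (ln (1 / \<delta>) + 3 * ln (real K)) * ?Q)
      \<le> 10 ^ 5 * (real K * (ln (1 / \<delta>) + ln (real K)) * ?Q)" .
  have bound2: "10240 * (real K * (ln (1 / \<delta>) + 3 * ln (real K)) * ?Q)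
      \<le> 10 ^ 5 * (1 + ln (real K)) * (real K * ln (1 / \<delta>) * ?Q)" if "\<delta> \<le> 1 / 2"
  proof -
    have "ln 2 \<le> ln (1 / \<delta>)" using that delta_range by (subst ln_le_cancel_iff) (auto simp: field_simps)
    then have "1 / 2 \<le> ln (1 / \<delta>)" using ln2_ge_two_thirds by linarith
    \<comment> \<open>this turns the sum of the two logarithms into a product\<close>
    then have "3 * ln (real K) \<le> 6 * ln (real K) * ln (1 / \<delta>)"
      using lnK mult_left_mono[of "1 / 2" "ln (1 / \<delta>)" "6 * ln (real K)"] by simp
    then have "ln (1 / \<delta>) + 3 * ln (real K) \<le> 6 * (1 + ln (real K)) * ln (1 / \<delta>)"
      using ln\<delta> by (simp add: algebra_simps)
    then have "10240 * (real K * (ln (1 / \<delta>) + 3 * ln (real K)) * ?Q)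
        \<le> 10240 * (real K * (6 * (1 + ln (real K)) * ln (1 / \<delta>)) * ?Q)"
      by (intro mult_left_mono mult_right_mono) auto
    also have "\<dots> = 61440 * ((1 + ln (real K)) * (real K * ln (1 / \<delta>) * ?Q))" by (simp add: mult_ac)
    also have "\<dots> \<le> 10 ^ 5 * ((1 + ln (real K)) * (real K * ln (1 / \<delta>) * ?Q))"
      using lnK ln\<delta> by (intro mult_right_mono) auto
    finally show ?thesis by (simp only: mult.assoc)
  qed
  show ?thesis
    using success order_trans[OF iter bound1] order_trans[OF iter bound2] unfolding B_def by blast
qed

end
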